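(* Let $(L,\psi,h)$ be a polarised integral Hodge structure. If $L=L_1\perp\cdots\perp L_r$ is an orthogonal decomposition into indecomposable polarised integral Hodge substructures, then the set of sublattices $\{L_i\}$ is uniquely determined by $L$: any other such decomposition $L=L'_1\perp\cdots\perp L'_s$ satisfies $\{L'_j\}_j=\{L_i\}_i$.
   Context: An integral Hodge structure is a finitely generated free $\mathbb{Z}$-module $L$ together with a decomposition $L_{\mathbb{C}}=\bigoplus_{(p,q)\in\mathbb{Z}^2}V^{p,q}$ (where $L_\mathbb{C}=L\otimes\mathbb{C}$, with complex conjugation acting on the factor $\mathbb{C}$) satisfying $\overline{V^{p,q}}=V^{q,p}$, such that, writing $(L_\mathbb{R})^n$ for the real subspace with $(L_\mathbb{R})^n\otimes\mathbb{C}=\bigoplus_{p+q=n}V^{p,q}$, one has $L=\bigoplus_n L^n$ with $L^n:=L\cap(L_\mathbb{R})^n$. Equivalently it is given by the real representation $h:\mathbb{C}^\times\to\mathrm{GL}(L_\mathbb{R})$, where $h(z)$ acts on $V^{p,q}$ by $z^{-p}\bar z^{-q}$. For $n\in\mathbb{Z}$ let $\mathbb{Z}(-n)=(2\pi i)^{-n}\mathbb{Z}$ and $\mathbb{R}(-n)=(2\pi i)^{-n}\mathbb{R}$. A polarisation is a $\mathbb{Z}$-bilinear pairing $\psi$ on $L$ with $\psi(L^n,L^m)=0$ for $n\neq m$ and, for each $n$, $\psi$ restricted to $L^n\times L^n$ takes values in $\mathbb{Z}(-n)$ and satisfies: (a) $\psi_\mathbb{R}(h(z)x,h(z)y)=(z\bar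 z)^{-n}\psi_\mathbb{R}(x,y)$ for all $x,y\in (L_\mathbb{R})^n$, $z\in\mathbb{C}^\times$; (b) the form $\varphi(x,y)=(2\pi i)^n\psi_\mathbb{R}(x,h(i)y)$ on $(L_\mathbb{R})^n$ is real-valued, symmetric and positive definite. An orthogonal decomposition $L=L_1\perp\cdots\perp L_r$ means $L=\bigoplus_\nu L_\nu$ where each $L_\nu$ is a $\mathbb{Z}$-submodule with $L_\nu\otimes\mathbb{R}$ stable under $h(z)$ for all $z\in\mathbb{C}^\times$ (a Hodge substructure), and $\psi(L_\nu,L_\mu)=0$ for $\nu\neq\mu$. A nonzero $(L,\psi,h)$ is indecomposable if whenever $L=L_1\perp L_2$ is an orthogonal decomposition, $L_1=0$ or $L_2=0$; a substructure $L_\nu$ is regarded with the restricted $\psi$ and $h$. *)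

theory Defs
  imports Complex_Main
begin

text \<open>The canonical map from the external direct sum of the \<open>M i\<close> to \<open>A\<close> is bijective.\<close>

definition internal_direct_sum :: "'i set \<Rightarrow> ('i \<Rightarrow> 'v::ab_group_add set) \<Rightarrow> 'v set \<Rightarrow> bool" where
  "internal_direct_sum I M A \<longleftrightarrow>
     bij_betw (\<lambda>f. \<Sum>i | f i \<noteq> 0. f i)
       {f. finite {i. f i \<noteq> 0} \<and> (\<forall>i\<in>I. f i \<in> M i) \<and> (\<forall>i. i \<notin> I \<longrightarrow> f i = 0)} A"

definition biadditive_on :: "'v::ab_group_add set \<Rightarrow> ('v \<Rightarrow> 'v \<Rightarrow> complex) \<Rightarrow> bool" where
  "biadditive_on M \<beta> \<longleftrightarrow>
     (\<forall>x\<in>M. \<forall>y\<in>M. \<forall>z\<in>M. \<beta> (x + y) z = \<beta> x z + \<beta> y z \<and> \<beta> x (y + z) = \<beta> x y + \<beta> x z)"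

definition tate_twist :: "int \<Rightarrow> complex set" where
  "tate_twist m = range (\<lambda>k::int. (2 * of_real pi * \<i>) powi m * of_int k)"

locale complex_space = vector_space scale
  for scale :: "complex \<Rightarrow> 'v::ab_group_add \<Rightarrow> 'v" (infixr \<open>*c\<close> 75)
begin

sublocale Z: module "\<lambda>(k::int) x. of_int k *c x"
  by unfold_locales (simp_all add: scale_right_distrib scale_left_distrib)

sublocale R: vector_space "\<lambda>(r::real) x. of_real r *c x"
  by unfold_locales (simp_all add: scale_right_distrib scale_left_distrib)

end

text \<open>
  A finitely generated free abelian group \<open>L\<close> together with its complexification \<open>L \<otimes> \<complex>\<close>, which
  is the whole type \<open>'v\<close>; the map \<open>x \<mapsto> x \<otimes> 1\<close> is the inclusion of \<open>L\<close> in \<open>'v\<close>. That \<open>'v\<close> is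
  \<open>L \<otimes> \<complex>\<close> means that a \<open>\<int>\<close>-basis of \<open>L\<close> is a \<open>\<complex>\<close>-basis of \<open>'v\<close>. For a subgroup \<open>M\<close> of \<open>L\<close>,
  \<open>M \<otimes> \<real>\<close> is \<open>R.span M\<close>.
\<close>

locale complexified_lattice = complex_space scale
  for scale :: "complex \<Rightarrow> 'v::ab_group_add \<Rightarrow> 'v" (infixr \<open>*c\<close> 75) +
  fixes L :: "'v set"
  assumes lattice_basis: "\<exists>B. finite B \<and> independent B \<and> span B = UNIV \<and> L = Z.span B"
begin

text \<open>The map \<open>x \<otimes> a \<mapsto> x \<otimes> cnj a\<close>.\<close>

definition conjugation :: "'v \<Rightarrow> 'v" where
  "conjugation = (THE c. (\<forall>x y. c (x + y) = c x + c y) \<and> (\<forall>a. \<forall>x\<in>L. c (a *c x) = cnj a *c x))"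

end

locale hodge_decomposition = complexified_lattice scale L
  for scale :: "complex \<Rightarrow> 'v::ab_group_add \<Rightarrow> 'v" (infixr \<open>*c\<close> 75) and L +
  fixes V :: "int \<times> int \<Rightarrow> 'v set"
  assumes V_subspace: "subspace (V (p, q))"
    and V_direct_sum: "internal_direct_sum UNIV V UNIV"
    and V_conjugation: "conjugation ` V (p, q) = V (q, p)"
begin

definition h :: "complex \<Rightarrow> 'v \<Rightarrow> 'v" where
  "h z = (THE f. (\<forall>x y. f (x + y) = f x + f y) \<and>
     (\<forall>p q. \<forall>x\<in>V (p, q). f x = (z powi (- p) * cnj z powi (- q)) *c x))"

text \<open>The space \<open>(L \<otimes> \<real>)\<^sup>n\<close>.\<close>

definition real_weight_part :: "int \<Rightarrow> 'v set" where
  "real_weight_part n = (THE W. R.subspace W \<and> W \<subseteq> R.span L \<and>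
     span W = span (\<Union>(p, q) \<in> {(p, q). p + q = n}. V (p, q)))"

definition weight_part :: "int \<Rightarrow> 'v set" where
  "weight_part n = L \<inter> real_weight_part n"

end

locale integral_hodge_structure = hodge_decomposition scale L V
  for scale :: "complex \<Rightarrow> 'v::ab_group_add \<Rightarrow> 'v" (infixr \<open>*c\<close> 75) and L V +
  assumes weight_direct_sum: "internal_direct_sum UNIV weight_part L"
begin

text \<open>
  The \<open>\<real>\<close>-bilinear extension of a pairing from \<open>L\<close> to \<open>L \<otimes> \<real>\<close>, set to \<open>0\<close> outside
  \<open>L \<otimes> \<real>\<close> so that it is unique as a function on \<open>'v\<close>.
\<close>

definition real_extension :: "('v \<Rightarrow> 'v \<Rightarrow> complex) \<Rightarrow> 'v \<Rightarrow> 'v \<Rightarrow> complex" where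
  "real_extension \<psi> = (THE \<beta>. biadditive_on (R.span L) \<beta> \<and>
     (\<forall>a b :: real. \<forall>x\<in>L. \<forall>y\<in>L.
        \<beta> (of_real a *c x) (of_real b *c y) = of_real a * of_real b * \<psi> x y) \<and>
     (\<forall>x y. x \<notin> R.span L \<or> y \<notin> R.span L \<longrightarrow> \<beta> x y = 0))"

text \<open>The form \<open>\<phi>\<close> of weight \<open>n\<close> associated with the pairing \<open>\<psi>\<close>.\<close>

definition hodge_form :: "('v \<Rightarrow> 'v \<Rightarrow> complex) \<Rightarrow> int \<Rightarrow> 'v \<Rightarrow> 'v \<Rightarrow> complex" where
  "hodge_form \<psi> n x y = (2 * of_real pi * \<i>) powi n * real_extension \<psi> x (h \<i> y)"

end

text \<open>Only the values of \<open>\<psi>\<close> on \<open>L \<times> L\<close> matter.\<close>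

locale polarised_integral_hodge_structure = integral_hodge_structure scale L V
  for scale :: "complex \<Rightarrow> 'v::ab_group_add \<Rightarrow> 'v" (infixr \<open>*c\<close> 75) and L V +
  fixes \<psi> :: "'v \<Rightarrow> 'v \<Rightarrow> complex"
  assumes psi_biadditive: "biadditive_on L \<psi>"
    and psi_weights: "n \<noteq> m \<Longrightarrow> x \<in> weight_part n \<Longrightarrow> y \<in> weight_part m \<Longrightarrow> \<psi> x y = 0"
    and psi_values: "x \<in> weight_part n \<Longrightarrow> y \<in> weight_part n \<Longrightarrow> \<psi> x y \<in> tate_twist (- n)"
    and psi_h: "x \<in> real_weight_part n \<Longrightarrow> y \<in> real_weight_part n \<Longrightarrow> z \<noteq> 0 \<Longrightarrow>
      real_extension \<psi> (h z x) (h z y) = (z * cnj z) powi (- n) * real_extension \<psi> x y"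
    and hodge_form_real: "x \<in> real_weight_part n \<Longrightarrow> y \<in> real_weight_part n \<Longrightarrow>
      hodge_form \<psi> n x y \<in> \<real>"
    and hodge_form_sym: "x \<in> real_weight_part n \<Longrightarrow> y \<in> real_weight_part n \<Longrightarrow>
      hodge_form \<psi> n x y = hodge_form \<psi> n y x"
    and hodge_form_pos: "x \<in> real_weight_part n \<Longrightarrow> x \<noteq> 0 \<Longrightarrow> Re (hodge_form \<psi> n x x) > 0"
begin

text \<open>
  The relation \<open>M = N\<^sub>1 \<perp> \<dots> \<perp> N\<^sub>r\<close>, where \<open>M\<close> is \<open>L\<close> or a Hodge substructure of \<open>L\<close>, with the
  restrictions of \<open>\<psi>\<close> and \<open>h\<close>.
\<close>

definition orthogonal_decomposition :: "'v set \<Rightarrow> nat \<Rightarrow> (nat \<Rightarrow> 'v set) \<Rightarrow> bool" where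
  "orthogonal_decomposition M r N \<longleftrightarrow>
     internal_direct_sum {1..r} N M \<and>
     (\<forall>\<nu>\<in>{1..r}. Z.subspace (N \<nu>) \<and>
        (\<forall>z. z \<noteq> 0 \<longrightarrow> h z ` R.span (N \<nu>) \<subseteq> R.span (N \<nu>))) \<and>
     (\<forall>\<nu>\<in>{1..r}. \<forall>\<mu>\<in>{1..r}. \<nu> \<noteq> \<mu> \<longrightarrow> (\<forall>x \<in> N \<nu>. \<forall>y \<in> N \<mu>. \<psi> x y = 0))"

definition indecomposable :: "'v set \<Rightarrow> bool" where
  "indecomposable M \<longleftrightarrow>
     M \<noteq> {0} \<and> (\<forall>N. orthogonal_decomposition M 2 N \<longrightarrow> N 1 = {0} \<or> N 2 = {0})"

end

end

theory Submission
  imports Defs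
begin

text \<open>
  An orthogonal decomposition is the same as a family of projections that preserve \<open>L\<close>, commute with
  \<open>h\<close> and are orthogonal for \<open>\<psi>\<close>. The point is that any two such projections \<open>P\<close>, \<open>Q\<close> commute. On
  \<open>L\<^sup>n\<close> they are orthogonal for the positive definite form \<open>\<phi>\<close>, for which \<open>L\<^sup>n\<close> is discrete: only
  finitely many \<open>x\<close> have \<open>\<phi>(x, x)\<close> below a given bound. If \<open>P x\<close> is neither \<open>0\<close> nor \<open>x\<close>, then
  \<open>x = P x + (x - P x)\<close> writes \<open>x\<close> as a sum of two vectors of smaller norm, and likewise for \<open>Q\<close>; if
  \<open>P x\<close> and \<open>Q x\<close> both lie in \<open>{0, x}\<close>, then \<open>P (Q x) = Q (P x)\<close> is trivial. This is Eichler's argument.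
  Hence \<open>Q\<close> splits \<open>P L\<close> into the orthogonal substructures \<open>Q P L\<close> and \<open>(1 - Q) P L\<close>, so indecomposability
  of \<open>P L\<close> forces \<open>Q P = 0\<close> or \<open>Q P = P\<close>, and symmetrically for \<open>Q L\<close>.
\<close>

section \<open>Internal direct sums\<close>

text \<open>The definition of \<open>internal_direct_sum\<close> is a bare bijection; closure of the
  summands under \<open>0\<close> and \<open>+\<close> is what makes its inverse additive. The
  locale serves the Hodge decomposition, the weight decomposition and the orthogonal decompositions
  alike.\<close>

locale direct_sum =
  fixes I :: "'i set" and M :: "'i \<Rightarrow> 'v::ab_group_add set" and A :: "'v set"
  assumes direct: "internal_direct_sum I M A"
    and summand_zero: "i \<in> I \<Longrightarrow> 0 \<in> M i"
    and summand_add: "i \<in> I \<Longrightarrow> x \<in> M i \<Longrightarrow> y \<in> M i \<Longrightarrow> x + y \<in> M i"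
begin

definition families :: "('i \<Rightarrow> 'v) set" where
  "families = {f. finite {i. f i \<noteq> 0} \<and> (\<forall>i\<in>I. f i \<in> M i) \<and> (\<forall>i. i \<notin> I \<longrightarrow> f i = 0)}"

text \<open>The inverse of the summation bijection, so its value is unspecified outside
  \<open>A\<close>.\<close>

definition component :: "'v \<Rightarrow> 'i \<Rightarrow> 'v" where
  "component = inv_into families (\<lambda>f. \<Sum>i | f i \<noteq> 0. f i)"

lemma bij_families: "bij_betw (\<lambda>f. \<Sum>i | f i \<noteq> 0. f i) families A"
  using direct by (simp add: internal_direct_sum_def families_def)

lemma component_families: "x \<in> A \<Longrightarrow> component x \<in> families"
  unfolding component_def using bij_betw_imp_surj_on[OF bij_families] by (intro inv_into_into) simp

lemma finite_component: "x \<in> A \<Longrightarrow> finite {i. component x i \<noteq> 0}"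
  and component_mem: "x \<in> A \<Longrightarrow> i \<in> I \<Longrightarrow> component x i \<in> M i"
  and component_outside: "x \<in> A \<Longrightarrow> i \<notin> I \<Longrightarrow> component x i = 0"
  using component_families by (auto simp: families_def)

lemma sum_support: "finite J \<Longrightarrow> {i. f i \<noteq> 0} \<subseteq> J \<Longrightarrow> (\<Sum>i | f i \<noteq> 0. f i) = sum f J"
  for f :: "'i \<Rightarrow> 'v"
  by (rule sum.mono_neutral_left) auto

lemma sum_component:
  assumes "x \<in> A" "finite J" "{i. component x i \<noteq> 0} \<subseteq> J"
  shows "(\<Sum>i\<in>J. component x i) = x"
  using bij_betw_inv_into_right[OF bij_families assms(1)] sum_support[OF assms(2,3)]
  unfolding component_def by simp

text \<open>Uniqueness in a usable form: components of a vector are computed by exhibiting one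
  admissible family with the right sum, over any finite set that contains its support.\<close>

lemma
  assumes "f \<in> families" "finite J" "{i. f i \<noteq> 0} \<subseteq> J"
  shows sum_families_mem: "sum f J \<in> A" and component_sum: "component (sum f J) = f"
proof -
  have eq: "(\<Sum>i | f i \<noteq> 0. f i) = sum f J" by (rule sum_support[OF assms(2,3)])
  show "sum f J \<in> A" using bij_betwE[OF bij_families] assms(1) eq by fastforce
  show "component (sum f J) = f"
    unfolding component_def using bij_betw_inv_into_left[OF bij_families assms(1)] eq by simp
qed

lemma
  assumes "i \<in> I" "x \<in> M i"
  shows summand_subset: "x \<in> A"
    and component_summand: "component x = (\<lambda>j. if j = i then x else 0)"
proof -
  let ?f = "\<lambda>j. if j = i then x else 0"
  have f: "?f \<in> families"
    using assms summand_zero by (auto simp: families_def)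
  have sub: "{j. ?f j \<noteq> 0} \<subseteq> {i}" by auto
  have s: "sum ?f {i} = x" by simp
  show "x \<in> A" using sum_families_mem[OF f _ sub] s by simp
  show "component x = ?f" using component_sum[OF f _ sub] s by simp
qed

lemma component_add:
  assumes "x \<in> A" "y \<in> A"
  shows "component (x + y) i = component x i + component y i"
proof -
  let ?f = "\<lambda>i. component x i + component y i"
  let ?J = "{i. component x i \<noteq> 0} \<union> {i. component y i \<noteq> 0}"
  have fin: "finite ?J" using finite_component assms by auto
  have sub: "{i. ?f i \<noteq> 0} \<subseteq> ?J" by auto
  have f: "?f \<in> families"
    using assms summand_add component_mem component_outside finite_subset[OF sub fin]
    by (auto simp: families_def)
  have s: "sum ?f ?J = x + y"
    using assms fin by (simp only: sum.distrib) (intro arg_cong2[of _ _ _ _ "(+)"] sum_component; auto)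
  show "component (x + y) i = component x i + component y i"
    using component_sum[OF f fin sub] s by metis
qed

end

text \<open>The inverse of the summation map sends \<open>x\<close> to the pair \<open>T x\<close>,
  \<open>x - T x\<close>. This is how a projection will split a substructure into two
  summands.\<close>

lemma internal_direct_sum_pair:
  fixes X Y A :: "'v::ab_group_add set" and T :: "'v \<Rightarrow> 'v"
  assumes X: "X \<subseteq> A" "\<And>x. x \<in> X \<Longrightarrow> T x = x"
    and Y: "Y \<subseteq> A" "\<And>y. y \<in> Y \<Longrightarrow> T y = 0"
    and A: "\<And>x y. x \<in> A \<Longrightarrow> y \<in> A \<Longrightarrow> x + y \<in> A"
      "\<And>x y. x \<in> A \<Longrightarrow> y \<in> A \<Longrightarrow> T (x + y) = T x + T y"
      "\<And>x. x \<in> A \<Longrightarrow> T x \<in> X" "\<And>x. x \<in> A \<Longrightarrow> x - T x \<in> Y"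
  shows "internal_direct_sum {1..2::nat} (\<lambda>k. if k = 1 then X else Y) A"
proof -
  define F :: "(nat \<Rightarrow> 'v) set"
    where "F = {f. finite {i. f i \<noteq> 0} \<and> (\<forall>i\<in>{1..2}. f i \<in> (if i = 1 then X else Y)) \<and>
      (\<forall>i. i \<notin> {1..2} \<longrightarrow> f i = 0)}"
  define g where "g x k = (if k = 1 then T x else if k = 2 then x - T x else 0)" for x and k :: nat
  have I: "{1..2::nat} = {1, 2}" by auto
  have supp: "{i. f i \<noteq> 0} \<subseteq> {1, 2}" if "\<And>k. k \<noteq> 1 \<Longrightarrow> k \<noteq> 2 \<Longrightarrow> f k = 0" for f :: "nat \<Rightarrow> 'v"
    using that by blast
  have F: "f \<in> F \<longleftrightarrow> f 1 \<in> X \<and> f 2 \<in> Y \<and> (\<forall>k. k \<noteq> 1 \<longrightarrow> k \<noteq> 2 \<longrightarrow> f k = 0)" for f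
  proof -
    have "finite {i. f i \<noteq> 0}" if "\<forall>k. k \<noteq> 1 \<longrightarrow> k \<noteq> 2 \<longrightarrow> f k = 0"
      using that by (intro finite_subset[OF supp]) simp_all
    then show ?thesis unfolding F_def I by (simp del: One_nat_def) blast
  qed
  have sum: "(\<Sum>i | f i \<noteq> 0. f i) = f 1 + f 2" if "\<And>k. k \<noteq> 1 \<Longrightarrow> k \<noteq> 2 \<Longrightarrow> f k = 0"
    for f :: "nat \<Rightarrow> 'v"
  proof -
    have "(\<Sum>i | f i \<noteq> 0. f i) = sum f {1, 2}"
      by (rule sum.mono_neutral_left[OF _ supp[OF that]]) simp_all
    then show ?thesis by simp
  qed
  have "bij_betw (\<lambda>f. \<Sum>i | f i \<noteq> 0. f i) F A"
  proof (rule bij_betw_byWitness[where f' = g])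
    show "\<forall>f\<in>F. g (\<Sum>i | f i \<noteq> 0. f i) = f"
    proof
      fix f assume "f \<in> F"
      then have f: "f 1 \<in> X" "f 2 \<in> Y" "\<And>k. k \<noteq> 1 \<Longrightarrow> k \<noteq> 2 \<Longrightarrow> f k = 0" unfolding F by blast+
      have s: "(\<Sum>i | f i \<noteq> 0. f i) = f 1 + f 2" by (rule sum) (rule f(3))
      have "T (f 1 + f 2) = T (f 1) + T (f 2)" using f X(1) Y(1) by (intro A(2)) blast+
      then have T: "T (f 1 + f 2) = f 1" using X(2)[OF f(1)] Y(2)[OF f(2)] by simp
      then have "g (f 1 + f 2) k = f k" for k
        using f(3)[of k] by (simp add: g_def)
      then show "g (\<Sum>i | f i \<noteq> 0. f i) = f"
        unfolding s by blast
    qed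
    have "g x \<in> F" if "x \<in> A" for x using A(3,4)[OF that] unfolding F g_def by simp
    then show "g ` A \<subseteq> F" by blast
    show "\<forall>x\<in>A. (\<Sum>i | g x i \<noteq> 0. g x i) = x"
      by (subst sum) (simp_all add: g_def)
    show "(\<lambda>f. \<Sum>i | f i \<noteq> 0. f i) ` F \<subseteq> A"
    proof (intro image_subsetI)
      fix f assume "f \<in> F"
      then have f: "f 1 \<in> X" "f 2 \<in> Y" "\<And>k. k \<noteq> 1 \<Longrightarrow> k \<noteq> 2 \<Longrightarrow> f k = 0" unfolding F by blast+
      have s: "(\<Sum>i | f i \<noteq> 0. f i) = f 1 + f 2" by (rule sum) (rule f(3))
      show "(\<Sum>i | f i \<noteq> 0. f i) \<in> A"
        unfolding s using f X(1) Y(1) by (intro A(1)) blast+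
    qed
  qed
  then show ?thesis unfolding internal_direct_sum_def F_def .
qed

section \<open>Positive definite forms and descent\<close>

text \<open>The axioms are relative to a subspace \<open>W\<close> because the forms to be treated
  live on the real weight spaces inside one complex vector space.\<close>

locale positive_definite_form = vector_space scale
  for scale :: "real \<Rightarrow> 'v::ab_group_add \<Rightarrow> 'v" +
  fixes W :: "'v set" and q :: "'v \<Rightarrow> 'v \<Rightarrow> real"
  assumes W: "subspace W"
    and q_add_left: "x \<in> W \<Longrightarrow> y \<in> W \<Longrightarrow> z \<in> W \<Longrightarrow> q (x + y) z = q x z + q y z"
    and q_scale_left: "x \<in> W \<Longrightarrow> z \<in> W \<Longrightarrow> q (scale a x) z = a * q x z"
    and q_sym: "x \<in> W \<Longrightarrow> y \<in> W \<Longrightarrow> q x y = q y x"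
    and q_pos: "x \<in> W \<Longrightarrow> x \<noteq> 0 \<Longrightarrow> q x x > 0"
begin

lemma q_add_right: "x \<in> W \<Longrightarrow> y \<in> W \<Longrightarrow> z \<in> W \<Longrightarrow> q z (x + y) = q z x + q z y"
  using q_add_left q_sym W by (simp add: subspace_add)

lemma q_scale_right: "x \<in> W \<Longrightarrow> z \<in> W \<Longrightarrow> q z (scale a x) = a * q z x"
  using q_scale_left q_sym W by (simp add: subspace_scale)

lemma q_zero_left: "z \<in> W \<Longrightarrow> q 0 z = 0"
  using q_scale_left[of 0 z 0] subspace_0[OF W] by simp

lemma q_nonneg: "x \<in> W \<Longrightarrow> q x x \<ge> 0"
  using q_pos[of x] q_zero_left[of 0] by (cases "x = 0") auto

lemma Cauchy_Schwarz:
  assumes "x \<in> W" "y \<in> W"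
  shows "(q x y)\<^sup>2 \<le> q x x * q y y"
proof (cases "y = 0")
  case True
  then show ?thesis using assms q_zero_left[of x] q_zero_left[of 0] q_sym[of x 0] by simp
next
  case False
  \<comment> \<open>The minimiser of the form at \<open>x + a y\<close> over real \<open>a\<close>;
    nonnegativity there is the inequality.\<close>
  define a where "a = - (q x y / q y y)"
  have pos: "q y y > 0" using q_pos assms False by simp
  have ay: "scale a y \<in> W" using W assms by (simp add: subspace_scale)
  have "0 \<le> q (x + scale a y) (x + scale a y)"
    using q_nonneg W assms ay by (simp add: subspace_add)
  also have "\<dots> = q x x + 2 * a * q x y + a * a * q y y"
    using assms ay W
    by (simp add: q_add_left q_add_right q_scale_left q_scale_right q_sym[of y x] subspace_add algebra_simps)
  also have "\<dots> = q x x - (q x y)\<^sup>2 / q y y"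
    using pos by (simp add: a_def field_simps power2_eq_square)
  finally show ?thesis using pos by (simp add: field_simps)
qed

text \<open>Gram-Schmidt: subtracting from the new vector \<open>s\<close> its orthogonal projection
  \<open>v\<close> to \<open>span S\<close> leaves \<open>u\<close> orthogonal to \<open>S\<close>
  with \<open>q s u = q u u\<close>, which is nonzero. A multiple of \<open>u\<close> then corrects
  the value at \<open>s\<close> without disturbing those on \<open>S\<close>.\<close>

lemma riesz_representation_basis:
  assumes "finite S" "independent S" "S \<subseteq> W"
  shows "\<exists>w\<in>span S. \<forall>s\<in>S. q s w = f s"
  using assms
proof (induction S arbitrary: f rule: finite_induct)
  case empty
  then show ?case by (auto intro: span_zero)
next
  case (insert s S)
  then have S: "independent S" "S \<subseteq> W" "s \<notin> span S" "s \<in> W"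
    by (auto simp: independent_insert)
  have spanW: "span S \<subseteq> W" using S W by (simp add: span_minimal)
  obtain w where w: "w \<in> span S" "\<forall>t\<in>S. q t w = f t" using insert.IH[of f] S by blast
  \<comment> \<open>A second use of the induction hypothesis, for the functional given by
    \<open>s\<close> itself; hence the generalisation over \<open>f\<close>.\<close>
  obtain v where v: "v \<in> span S" "\<forall>t\<in>S. q t v = q t s" using insert.IH[of "\<lambda>t. q t s"] S by blast
  define u where "u = s + scale (-1) v"
  have W': "w \<in> W" "v \<in> W" "scale (-1) v \<in> W" "u \<in> W"
    using spanW w v S W by (auto simp: u_def subspace_neg subspace_diff)
  have u0: "u \<noteq> 0" using S(3) v(1) by (auto simp: u_def)
  have orth: "q t u = 0" if "t \<in> S" for t
    using that v S W' q_scale_right[of v t "-1"] unfolding u_def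
    by (subst q_add_right) auto
  have "span S \<subseteq> {t \<in> W. q t u = 0}"
    using S W W' orth
    by (intro span_minimal)
      (auto simp: subspace_def q_add_left q_scale_left q_zero_left)
  then have "q v u = 0" using v by auto
  then have "q u u = q s u"
    using W' S q_scale_left[of v u "-1"] by (subst u_def, subst q_add_left) auto
  then have su: "q s u \<noteq> 0" using q_pos[OF W'(4) u0] by simp
  define a where "a = (f s - q s w) / q s u"
  have au: "scale a u \<in> W" using W W' by (simp add: subspace_scale)
  have "q t (w + scale a u) = f t" if "t \<in> insert s S" for t
    using that w(2) orth S W' au su by (auto simp: q_add_right q_scale_right a_def subset_iff)
  moreover have "w + scale a u \<in> span (insert s S)"
    using w(1) v(1) span_mono[of S "insert s S"] unfolding u_def
    by (intro span_add span_scale) (auto intro: span_base)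
  ultimately show ?case by blast
qed

text \<open>Meant for coordinate functionals: together with \<open>Cauchy_Schwarz\<close> it bounds
  each coordinate of a vector by its norm. The set \<open>T\<close> guarantees finite
  dimension.\<close>

lemma riesz_representation:
  assumes "finite T" "W \<subseteq> span T"
    and f_add: "\<And>x y. f (x + y) = f x + f y" and f_scale: "\<And>a x. f (scale a x) = a * f x"
  shows "\<exists>w\<in>W. \<forall>x\<in>W. q x w = f x"
proof -
  obtain S where S: "S \<subseteq> W" "independent S" "W \<subseteq> span S" using maximal_independent_subset by blast
  have "finite S" using independent_span_bound[of T S] S assms by auto
  then obtain w where w: "w \<in> span S" "\<forall>s\<in>S. q s w = f s" using riesz_representation_basis S by blast
  have wW: "w \<in> W" using w(1) S(1) W span_minimal by blast
  have f0: "f 0 = 0" using f_scale[of 0 0] by simp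
  have "span S \<subseteq> {x \<in> W. q x w = f x}"
    using S W wW w
    by (intro span_minimal)
      (auto simp: subspace_def q_add_left q_scale_left q_zero_left f_add f_scale f0)
  then show ?thesis using wW S(3) by blast
qed

end

text \<open>Eichler's descent. Norms are real, so the induction runs on the number of elements of
  strictly smaller norm, which is finite by discreteness.\<close>

lemma norm_splitting_maps_commute:
  fixes A :: "'v::ab_group_add set" and N :: "'v \<Rightarrow> real"
  assumes discrete: "\<And>c. finite {x \<in> A. N x \<le> c}"
    and pos: "\<And>x. x \<in> A \<Longrightarrow> x \<noteq> 0 \<Longrightarrow> N x > 0"
    and diff: "\<And>x y. x \<in> A \<Longrightarrow> y \<in> A \<Longrightarrow> x - y \<in> A"
    and P: "\<And>x. x \<in> A \<Longrightarrow> P x \<in> A" "\<And>x y. x \<in> A \<Longrightarrow> y \<in> A \<Longrightarrow> P (x + y) = P x + P y"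
      "\<And>x. x \<in> A \<Longrightarrow> N x = N (P x) + N (x - P x)"
    and Q: "\<And>x. x \<in> A \<Longrightarrow> Q x \<in> A" "\<And>x y. x \<in> A \<Longrightarrow> y \<in> A \<Longrightarrow> Q (x + y) = Q x + Q y"
      "\<And>x. x \<in> A \<Longrightarrow> N x = N (Q x) + N (x - Q x)"
    and "x \<in> A"
  shows "P (Q x) = Q (P x)"
  using \<open>x \<in> A\<close>
proof (induction "card {y \<in> A. N y < N x}" arbitrary: x rule: less_induct)
  case less
  have fin: "finite {y \<in> A. N y < N x}"
    by (rule finite_subset[OF _ discrete[of "N x"]]) auto
  have IH: "P (Q y) = Q (P y)" if "y \<in> A" "N y < N x" for y
    by (rule less.hyps[OF psubset_card_mono[OF fin]]) (use that in auto)
  \<comment> \<open>Stated for an arbitrary map \<open>T\<close> so that it applies with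
    \<open>T\<close> equal to \<open>P\<close> and to \<open>Q\<close>. Both summands are nonzero,
    so each has norm strictly below \<open>N x\<close>.\<close>
  have split: "P (Q x) = Q (P x)"
    if T: "T x \<in> A" "N x = N (T x) + N (x - T x)" "T x \<noteq> 0" "T x \<noteq> x" for T
  proof -
    have A: "T x \<in> A" "x - T x \<in> A" using T diff less.prems by auto
    then have "N (T x) > 0" "N (x - T x) > 0" using pos T by auto
    then have c: "P (Q (T x)) = Q (P (T x))" "P (Q (x - T x)) = Q (P (x - T x))"
      using IH A T(2) by auto
    have "P (Q x) = P (Q (T x + (x - T x)))" by simp
    also have "\<dots> = P (Q (T x)) + P (Q (x - T x))" using A P Q by metis
    also have "\<dots> = Q (P (T x + (x - T x)))" using c A P Q by metis
    finally show ?thesis by simp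
  qed
  have zero: "0 \<in> A" using diff[OF less.prems less.prems] by simp
  have "P 0 = 0" "Q 0 = 0" using P(2)[OF zero zero] Q(2)[OF zero zero] by simp_all
  moreover have "P (Q x) = Q (P x)" if "P x \<noteq> 0" "P x \<noteq> x"
    using split[of P] P less.prems that by blast
  moreover have "P (Q x) = Q (P x)" if "Q x \<noteq> 0" "Q x \<noteq> x"
    using split[of Q] Q less.prems that by blast
  ultimately show ?case by metis
qed

section \<open>Coordinates, conjugation and the Hodge action\<close>

lemma sum_additive_on:
  fixes f :: "'a::ab_group_add \<Rightarrow> 'b::ab_group_add"
  assumes "0 \<in> A" and "\<And>x y. x \<in> A \<Longrightarrow> y \<in> A \<Longrightarrow> x + y \<in> A"
    and f: "\<And>x y. x \<in> A \<Longrightarrow> y \<in> A \<Longrightarrow> f (x + y) = f x + f y"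
    and "finite S" and "\<And>s. s \<in> S \<Longrightarrow> g s \<in> A"
  shows "f (sum g S) = (\<Sum>s\<in>S. f (g s))"
proof -
  have f0: "f 0 = 0" using f[of 0 0] assms(1) by simp
  have "sum g S \<in> A \<and> f (sum g S) = (\<Sum>s\<in>S. f (g s))"
    using assms(4,5) by (induction rule: finite_induct) (simp_all add: assms(1,2) f f0)
  then show ?thesis ..
qed

lemma sum_additive:
  fixes f :: "'a::ab_group_add \<Rightarrow> 'b::ab_group_add"
  assumes "\<And>x y. f (x + y) = f x + f y"
  shows "f (sum g S) = (\<Sum>s\<in>S. f (g s))"
  using additive.sum[of f g S] assms by (simp add: additive_def)

section \<open>Lattice coordinates and complex conjugation\<close>

context complexified_lattice
begin

text \<open>
  Since \<open>basis\<close> depends on \<open>L\<close>, rewriting \<open>L\<close> to \<open>Z.span basis\<close> does not terminate.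
\<close>

definition basis :: "'v set" where
  "basis = (SOME B. finite B \<and> independent B \<and> span B = UNIV \<and> L = Z.span B)"

lemma
  shows finite_basis: "finite basis" and independent_basis: "independent basis"
    and span_basis: "span basis = UNIV" and span_int_basis: "Z.span basis = L"
  using someI_ex[OF lattice_basis] unfolding basis_def[symmetric] by blast+

definition coord :: "'v \<Rightarrow> 'v \<Rightarrow> complex" where
  "coord b x = representation basis x b"

lemma coord_add: "coord b (x + y) = coord b x + coord b y"
  unfolding coord_def using independent_basis span_basis by (simp add: representation_add)

lemma coord_scale: "coord b (a *c x) = a * coord b x"
  unfolding coord_def using independent_basis span_basis by (simp add: representation_scale)

lemma coord_zero: "coord b 0 = 0"
  using coord_scale[of b 0 0] by simp

lemma coord_diff: "coord b (x - y) = coord b x - coord b y"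
  using coord_add[of b "x - y" y] by simp

lemma coord_minus: "coord b (- x) = - coord b x"
  using coord_diff[of b 0 x] by (simp add: coord_zero)

lemma coord_basis: "b' \<in> basis \<Longrightarrow> coord b b' = (if b = b' then 1 else 0)"
  unfolding coord_def using independent_basis by (simp add: representation_basis)

lemma sum_coord: "(\<Sum>b\<in>basis. coord b x *c b) = x"
  unfolding coord_def using independent_basis finite_basis span_basis
  by (simp add: sum_representation_eq)

lemma coord_sum_basis:
  assumes "b \<in> basis"
  shows "coord b (\<Sum>b'\<in>basis. a b' *c b') = a b"
proof -
  have "coord b (\<Sum>b'\<in>basis. a b' *c b') = (\<Sum>b'\<in>basis. if b = b' then a b' else 0)"
    unfolding sum_additive[of "coord b", OF coord_add]
    by (intro sum.cong) (auto simp: coord_scale coord_basis)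
  then show ?thesis using assms finite_basis by simp
qed

lemma coord_eqI:
  assumes "\<And>b. b \<in> basis \<Longrightarrow> coord b x = coord b y"
  shows "x = y"
proof -
  have "(\<Sum>b\<in>basis. coord b x *c b) = (\<Sum>b\<in>basis. coord b y *c b)"
    by (rule sum.cong) (simp_all add: assms)
  then show ?thesis by (simp only: sum_coord)
qed

text \<open>A basis of \<open>L\<close> over the integers is a complex basis of the whole space, so
  lattice membership is integrality of coordinates; membership in \<open>R.span L\<close> will
  likewise be reality of coordinates.\<close>

lemma mem_L_iff: "x \<in> L \<longleftrightarrow> (\<forall>b\<in>basis. coord b x \<in> \<int>)"
proof
  assume "x \<in> L"
  then have "x \<in> Z.span basis" by (simp add: span_int_basis)
  then show "\<forall>b\<in>basis. coord b x \<in> \<int>"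
    by (induction rule: Z.span_induct_alt)
      (auto simp: coord_zero coord_add coord_scale coord_basis)
next
  assume "\<forall>b\<in>basis. coord b x \<in> \<int>"
  then have "coord b x *c b \<in> Z.span basis" if "b \<in> basis" for b
    using that Z.span_scale[OF Z.span_base[OF that]] by (metis Ints_cases)
  then have "(\<Sum>b\<in>basis. coord b x *c b) \<in> Z.span basis"
    by (intro Z.span_sum)
  then show "x \<in> L" unfolding sum_coord span_int_basis .
qed

lemma coord_Ints: "x \<in> L \<Longrightarrow> b \<in> basis \<Longrightarrow> coord b x \<in> \<int>"
  by (simp add: mem_L_iff)

lemma basis_subset: "basis \<subseteq> L"
  using Z.span_superset[of basis] unfolding span_int_basis .

lemma mem_real_span_iff: "x \<in> R.span L \<longleftrightarrow> (\<forall>b\<in>basis. coord b x \<in> \<real>)"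
proof
  assume "x \<in> R.span L"
  then show "\<forall>b\<in>basis. coord b x \<in> \<real>"
  proof (induction rule: R.span_induct_alt)
    case (step c x y)
    have "coord b (of_real c *c x + y) \<in> \<real>" if "b \<in> basis" for b
      using step coord_Ints[OF step(1) that] that
      by (auto simp: coord_add coord_scale intro!: Reals_add Reals_mult elim: Ints_cases)
    then show ?case by blast
  qed (simp add: coord_zero)
next
  assume "\<forall>b\<in>basis. coord b x \<in> \<real>"
  then have "coord b x *c b \<in> R.span L" if "b \<in> basis" for b
    using that basis_subset R.span_scale[OF R.span_base, of b L] by (metis Reals_cases subsetD)
  then have "(\<Sum>b\<in>basis. coord b x *c b) \<in> R.span L"
    by (intro R.span_sum)
  then show "x \<in> R.span L" unfolding sum_coord .
qed

lemma L_add: "x \<in> L \<Longrightarrow> y \<in> L \<Longrightarrow> x + y \<in> L"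
  and L_diff: "x \<in> L \<Longrightarrow> y \<in> L \<Longrightarrow> x - y \<in> L"
  and L_zero: "0 \<in> L"
  and L_scale: "x \<in> L \<Longrightarrow> of_int k *c x \<in> L"
  by (auto simp: mem_L_iff coord_add coord_diff coord_zero coord_scale)

lemma L_real: "x \<in> L \<Longrightarrow> x \<in> R.span L"
  by (rule R.span_base)

text \<open>Additivity gives natural multiples, negatives and hence integer linearity. The
  right-hand side makes sense for every vector and is the complex linear extension of
  \<open>f\<close>. The target is general: it will be the complex numbers for pairings and the space
  itself for projections.\<close>

lemma additive_on_L:
  fixes s :: "complex \<Rightarrow> 'w::ab_group_add \<Rightarrow> 'w"
  assumes "vector_space s"
    and f: "\<And>x y. x \<in> L \<Longrightarrow> y \<in> L \<Longrightarrow> f (x + y) = f x + f y" and "x \<in> L"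
  shows "f x = (\<Sum>b\<in>basis. s (coord b x) (f b))"
proof -
  interpret W: vector_space s by fact
  have f0: "f 0 = 0" using f[of 0 0] L_zero by simp
  have fn: "f (of_nat n *c y) = s (of_nat n) (f y)" if "y \<in> L" for y n
  proof (induction n)
    case (Suc n)
    then show ?case using that f[of y "of_nat n *c y"] L_scale[of y "int n"]
      by (simp add: scale_left_distrib W.scale_left_distrib)
  qed (simp add: f0)
  have fm: "f (- y) = - f y" if "y \<in> L" for y
    using f[of "- y" y] that f0 L_diff[OF L_zero that] by (simp add: eq_neg_iff_add_eq_0)
  have fi: "f (of_int k *c y) = s (of_int k) (f y)" if "y \<in> L" for y k
  proof (cases k rule: int_cases2)
    case (nonneg n)
    then show ?thesis using fn that by simp
  next
    case (nonpos n)
    then show ?thesis using fn[OF that] fm[of "of_nat n *c y"] L_scale[OF that, of "int n"]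
      by (simp add: scale_minus_left)
  qed
  have "x \<in> Z.span basis" using \<open>x \<in> L\<close> by (simp add: span_int_basis)
  then have "x \<in> L \<and> f x = (\<Sum>b\<in>basis. s (coord b x) (f b))"
  proof (induction rule: Z.span_induct_alt)
    case base
    then show ?case by (simp add: f0 coord_zero L_zero)
  next
    case (step c b y)
    then have L: "b \<in> L" "y \<in> L" using basis_subset by auto
    have "f (of_int c *c b + y) = s (of_int c) (f b) + f y"
      using L fi f L_scale by simp
    also have "s (of_int c) (f b) = (\<Sum>b'\<in>basis. if b' = b then s (of_int c) (f b) else 0)"
      using step(1) finite_basis by simp
    also have "\<dots> = (\<Sum>b'\<in>basis. s (coord b' (of_int c *c b)) (f b'))"
      using step(1) by (intro sum.cong) (auto simp: coord_scale coord_basis)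
    finally show ?case
      using L step L_scale L_add by (simp add: coord_add W.scale_left_distrib sum.distrib)
  qed
  then show ?thesis ..
qed

text \<open>Supplies the finite real spanning set needed for the Riesz representation.\<close>

lemma real_span_basis: "R.span L \<subseteq> R.span basis"
proof
  fix x assume x: "x \<in> R.span L"
  have "coord b x *c b \<in> R.span basis" if b: "b \<in> basis" for b
  proof -
    obtain r where "coord b x = of_real r" using x b mem_real_span_iff Reals_cases by metis
    then show ?thesis using b by (auto intro: R.span_scale R.span_base)
  qed
  then have "(\<Sum>b\<in>basis. coord b x *c b) \<in> R.span basis" by (rule R.span_sum)
  then show "x \<in> R.span basis" by (simp only: sum_coord)
qed

lemma coord_scaled_mem:
  assumes "x \<in> R.span L" "b \<in> basis"
  shows "coord b x *c b \<in> R.span L"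
proof -
  obtain r where "coord b x = of_real r" using assms mem_real_span_iff Reals_cases by metis
  then show ?thesis using assms(2) basis_subset by (auto intro: R.span_scale L_real)
qed

text \<open>A merely additive map need not be real linear, so real coordinates stay inside
  \<open>f\<close>. The specification of \<open>real_extension\<close> prescribes exactly the values
  that are left.\<close>

lemma additive_on_real_span:
  fixes f :: "'v \<Rightarrow> 'w::ab_group_add"
  assumes f: "\<And>x y. x \<in> R.span L \<Longrightarrow> y \<in> R.span L \<Longrightarrow> f (x + y) = f x + f y"
    and "x \<in> R.span L"
  shows "f x = (\<Sum>b\<in>basis. f (coord b x *c b))"
proof -
  have mem: "coord b x *c b \<in> R.span L" if "b \<in> basis" for b
    using \<open>x \<in> R.span L\<close> that by (rule coord_scaled_mem)
  have "f (\<Sum>b\<in>basis. coord b x *c b) = (\<Sum>b\<in>basis. f (coord b x *c b))"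
    by (rule sum_additive_on[of "R.span L"]) (simp_all add: R.span_zero R.span_add f finite_basis mem)
  then show ?thesis by (simp only: sum_coord)
qed

text \<open>Resolves the definite description: conjugating all coordinates satisfies it, and
  additivity together with the values on complex multiples of basis vectors determines the
  map.\<close>

lemma
  shows conjugation_add: "conjugation (x + y) = conjugation x + conjugation y"
    and coord_conjugation: "b \<in> basis \<Longrightarrow> coord b (conjugation x) = cnj (coord b x)"
proof -
  define c where "c x = (\<Sum>b\<in>basis. cnj (coord b x) *c b)" for x
  have coord_c: "coord b (c x) = cnj (coord b x)" if "b \<in> basis" for b x
    unfolding c_def using that by (rule coord_sum_basis)
  have c_add: "c (x + y) = c x + c y" for x y
    by (rule coord_eqI) (simp add: coord_c coord_add)
  have "conjugation = c"
    unfolding conjugation_def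
  proof (rule the_equality)
    have "c (a *c x) = cnj a *c x" if "x \<in> L" for a x
    proof (rule coord_eqI)
      fix b assume "b \<in> basis"
      then show "coord b (c (a *c x)) = coord b (cnj a *c x)"
        using coord_Ints[OF that \<open>b \<in> basis\<close>] by (auto simp: coord_c coord_scale elim!: Ints_cases)
    qed
    then show "(\<forall>x y. c (x + y) = c x + c y) \<and> (\<forall>a. \<forall>x\<in>L. c (a *c x) = cnj a *c x)"
      using c_add by blast
  next
    fix c' assume c': "(\<forall>x y. c' (x + y) = c' x + c' y) \<and> (\<forall>a. \<forall>x\<in>L. c' (a *c x) = cnj a *c x)"
    show "c' = c"
    proof
      fix x
      have "c' x = c' (\<Sum>b\<in>basis. coord b x *c b)" by (simp add: sum_coord)
      also have "\<dots> = (\<Sum>b\<in>basis. c' (coord b x *c b))" using c' by (intro sum_additive) simp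
      also have "\<dots> = c x" unfolding c_def using c' basis_subset by (intro sum.cong) auto
      finally show "c' x = c x" .
    qed
  qed
  then show "conjugation (x + y) = conjugation x + conjugation y"
    and "b \<in> basis \<Longrightarrow> coord b (conjugation x) = cnj (coord b x)"
    using c_add coord_c by simp_all
qed

lemma conjugation_scale: "conjugation (a *c x) = cnj a *c conjugation x"
  by (rule coord_eqI) (simp add: coord_conjugation coord_scale)

text \<open>Reduces stability of \<open>R.span L\<close> under an operator to commutation with
  conjugation.\<close>

lemma mem_real_span_iff_conjugation: "x \<in> R.span L \<longleftrightarrow> conjugation x = x"
proof
  assume "x \<in> R.span L"
  then show "conjugation x = x"
    by (intro coord_eqI) (auto simp: mem_real_span_iff coord_conjugation Reals_cnj_iff)
next
  assume *: "conjugation x = x"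
  have "coord b x \<in> \<real>" if "b \<in> basis" for b
    using coord_conjugation[OF that, of x] unfolding * by (simp add: Reals_cnj_iff)
  then show "x \<in> R.span L" by (simp add: mem_real_span_iff)
qed

lemma real_span_Int_imaginary: "x \<in> R.span L \<Longrightarrow> \<i> *c x \<in> R.span L \<Longrightarrow> x = 0"
  by (rule coord_eqI)
    (simp add: mem_real_span_iff coord_scale coord_zero complex_is_Real_iff complex_eq_iff)

end

section \<open>Hodge components, the action \<open>h\<close> and the weight spaces\<close>

context hodge_decomposition
begin

sublocale hodge: direct_sum UNIV V UNIV
proof
  show "0 \<in> V i" for i using V_subspace[of "fst i" "snd i"] by (simp add: subspace_0)
  show "x + y \<in> V i" if "x \<in> V i" "y \<in> V i" for i x y
    using V_subspace[of "fst i" "snd i"] that by (simp add: subspace_add)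
qed (rule V_direct_sum)

lemma V_scale: "x \<in> V i \<Longrightarrow> a *c x \<in> V i"
  using V_subspace[of "fst i" "snd i"] by (simp add: subspace_scale)

lemma finite_hodge_component: "finite {i. hodge.component x i \<noteq> 0}"
  by (rule hodge.finite_component) simp

lemma sum_hodge_component: "(\<Sum>i | hodge.component x i \<noteq> 0. hodge.component x i) = x"
  by (rule hodge.sum_component) (auto simp: finite_hodge_component)

text \<open>Operators that are diagonal for the Hodge decomposition; scalar multiplication and
  \<open>h z\<close> are the two instances.\<close>

lemma component_scaled_sum:
  "hodge.component (\<Sum>i | hodge.component x i \<noteq> 0. a i *c hodge.component x i) =
    (\<lambda>i. a i *c hodge.component x i)"
proof (rule hodge.component_sum)
  have "finite {i. a i *c hodge.component x i \<noteq> 0}"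
    by (rule finite_subset[OF _ finite_hodge_component[of x]]) auto
  then show "(\<lambda>i. a i *c hodge.component x i) \<in> hodge.families"
    by (auto simp: hodge.families_def intro!: V_scale hodge.component_mem)
qed (auto simp: finite_hodge_component)

lemma component_scale: "hodge.component (a *c x) i = a *c hodge.component x i"
proof -
  have "hodge.component (a *c (\<Sum>i | hodge.component x i \<noteq> 0. hodge.component x i)) i =
      a *c hodge.component x i"
    unfolding scale_sum_right component_scaled_sum ..
  then show ?thesis by (simp only: sum_hodge_component)
qed

lemma component_eqI:
  assumes "hodge.component x = hodge.component y"
  shows "x = y"
proof -
  have "(\<Sum>i | hodge.component x i \<noteq> 0. hodge.component x i) =
      (\<Sum>i | hodge.component y i \<noteq> 0. hodge.component y i)"
    by (simp only: assms)
  then show ?thesis by (simp only: sum_hodge_component)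
qed

text \<open>The diagonal operator \<open>g\<close> satisfies the description of \<open>h z\<close>,
  and an additive map is determined by its values on the spaces \<open>V i\<close> because they
  span.\<close>

lemma component_h:
  "hodge.component (h z x) i = (z powi (- fst i) * cnj z powi (- snd i)) *c hodge.component x i"
proof -
  let ?\<chi> = "\<lambda>i. z powi (- fst i) * cnj z powi (- snd i)"
  define g where "g x = (\<Sum>i | hodge.component x i \<noteq> 0. ?\<chi> i *c hodge.component x i)" for x
  have comp: "hodge.component (g x) = (\<lambda>i. ?\<chi> i *c hodge.component x i)" for x
    unfolding g_def by (rule component_scaled_sum)
  have "h z = g"
    unfolding h_def
  proof (rule the_equality)
    have "g (x + y) = g x + g y" for x y
      by (rule component_eqI) (auto simp: comp hodge.component_add scale_right_distrib)
    moreover have "g x = ?\<chi> i *c x" if "x \<in> V i" for i x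
    proof (rule component_eqI)
      show "hodge.component (g x) = hodge.component (?\<chi> i *c x)"
        using that by (auto simp: fun_eq_iff comp component_scale hodge.component_summand[of i x])
    qed
    ultimately show "(\<forall>x y. g (x + y) = g x + g y) \<and>
        (\<forall>p q. \<forall>x\<in>V (p, q). g x = (z powi - p * cnj z powi - q) *c x)"
      by fastforce
  next
    fix f assume f: "(\<forall>x y. f (x + y) = f x + f y) \<and>
        (\<forall>p q. \<forall>x\<in>V (p, q). f x = (z powi - p * cnj z powi - q) *c x)"
    have fV: "f x = ?\<chi> i *c x" if "x \<in> V i" for x i
      using f that by (cases i) simp
    show "f = g"
    proof
      fix x
      have "f x = f (\<Sum>i | hodge.component x i \<noteq> 0. hodge.component x i)"
        by (simp add: sum_hodge_component)
      also have "\<dots> = (\<Sum>i | hodge.component x i \<noteq> 0. f (hodge.component x i))"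
        using f by (intro sum_additive) simp
      also have "\<dots> = g x"
        unfolding g_def by (intro sum.cong refl fV hodge.component_mem) auto
      finally show "f x = g x" .
    qed
  qed
  then show ?thesis using comp by simp
qed

lemma h_V: "x \<in> V (p, q) \<Longrightarrow> h z x = (z powi (- p) * cnj z powi (- q)) *c x"
  by (rule component_eqI)
    (auto simp: fun_eq_iff component_h component_scale hodge.component_summand[of "(p, q)" x])

lemma h_add: "h z (x + y) = h z x + h z y"
  by (rule component_eqI, rule ext) (simp only: component_h hodge.component_add[OF UNIV_I UNIV_I] scale_right_distrib)

lemma h_scale: "h z (a *c x) = a *c h z x"
  by (rule component_eqI, rule ext) (simp only: component_h component_scale scale_scale mult.commute[of a])

text \<open>Conjugation exchanges \<open>V (p, q)\<close> and \<open>V (q, p)\<close>, and the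
  scalars by which \<open>h z\<close> acts on these two spaces are conjugate to each other.\<close>

lemma conjugation_h: "conjugation (h z x) = h z (conjugation x)"
proof -
  have V: "conjugation (h z x) = h z (conjugation x)" if x: "x \<in> V i" for x i
  proof -
    obtain p q where i: "i = (p, q)" by fastforce
    have "conjugation x \<in> V (q, p)" using V_conjugation[of p q] x i by auto
    then show ?thesis
      using h_V[of x p q z] h_V[of "conjugation x" q p z] x i
      by (simp add: conjugation_scale mult.commute)
  qed
  have "conjugation (h z (\<Sum>i | hodge.component x i \<noteq> 0. hodge.component x i)) =
      h z (conjugation (\<Sum>i | hodge.component x i \<noteq> 0. hodge.component x i))"
    by (simp only: sum_additive[of "h z", OF h_add] sum_additive[of conjugation, OF conjugation_add]
        V[OF hodge.component_mem[OF UNIV_I UNIV_I]])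
  then show ?thesis by (simp only: sum_hodge_component)
qed

lemma h_real: "x \<in> R.span L \<Longrightarrow> h z x \<in> R.span L"
  by (simp add: mem_real_span_iff_conjugation conjugation_h)

definition complex_weight_part :: "int \<Rightarrow> 'v set" where
  "complex_weight_part n = span (\<Union>(p, q) \<in> {(p, q). p + q = n}. V (p, q))"

lemma component_zero: "hodge.component 0 i = 0"
  using component_scale[of 0 0] by simp

lemma mem_complex_weight_part_iff:
  "x \<in> complex_weight_part n \<longleftrightarrow> (\<forall>i. fst i + snd i \<noteq> n \<longrightarrow> hodge.component x i = 0)"
proof
  assume "x \<in> complex_weight_part n"
  then have "x \<in> span (\<Union>(p, q) \<in> {(p, q). p + q = n}. V (p, q))"
    by (simp add: complex_weight_part_def)
  then show "\<forall>i. fst i + snd i \<noteq> n \<longrightarrow> hodge.component x i = 0"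
  proof (induction rule: span_induct_alt)
    case base
    then show ?case by (simp add: component_zero)
  next
    case (step c x y)
    then obtain j where j: "fst j + snd j = n" "x \<in> V j" by auto
    show ?case
      using step(2) j hodge.component_summand[of j x]
      by (auto simp: hodge.component_add component_scale)
  qed
next
  assume *: "\<forall>i. fst i + snd i \<noteq> n \<longrightarrow> hodge.component x i = 0"
  have "hodge.component x i \<in> complex_weight_part n" if "hodge.component x i \<noteq> 0" for i
    unfolding complex_weight_part_def using * that hodge.component_mem[of x i]
    by (intro span_base) (cases i; fastforce)
  then have "(\<Sum>i | hodge.component x i \<noteq> 0. hodge.component x i) \<in> complex_weight_part n"
    unfolding complex_weight_part_def by (intro span_sum) auto
  then show "x \<in> complex_weight_part n" by (simp add: sum_hodge_component)
qed

text \<open>On \<open>V (p, q)\<close> the operator \<open>h 2\<close> is the scalar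
  \<open>2 powi (- (p + q))\<close>, and different weights give different scalars. The weight spaces
  are therefore eigenspaces, so a linear map that commutes with \<open>h 2\<close> preserves
  them.\<close>

lemma complex_weight_part_iff_h:
  "x \<in> complex_weight_part n \<longleftrightarrow> h 2 x = 2 powi (- n) *c x"
proof -
  \<comment> \<open>Complex powers are told apart by their norms, where strict monotonicity is
    available.\<close>
  have inj: "(2::complex) powi a = 2 powi b \<longleftrightarrow> a = b" for a b
  proof -
    have "norm ((2::complex) powi a) = 2 powi a" for a by (simp add: norm_power_int)
    moreover have "(2::real) powi a < 2 powi b" if "a < b" for a b
      using that by (intro power_int_strict_increasing) auto
    ultimately show ?thesis by (cases a b rule: linorder_cases) (metis less_irrefl, simp, metis less_irrefl)
  qed
  have "h 2 x = 2 powi (- n) *c x \<longleftrightarrow>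
      (\<forall>i. hodge.component (h 2 x) i = hodge.component (2 powi (- n) *c x) i)"
    using component_eqI[of "h 2 x"] by (auto simp: fun_eq_iff)
  also have "\<dots> \<longleftrightarrow> (\<forall>i. fst i + snd i \<noteq> n \<longrightarrow> hodge.component x i = 0)"
    by (auto simp: component_h component_scale inj power_int_add[symmetric] algebra_simps
        simp flip: power_int_minus)
  finally show ?thesis by (simp add: mem_complex_weight_part_iff)
qed

lemma conjugation_complex_weight_part:
  assumes "x \<in> complex_weight_part n"
  shows "conjugation x \<in> complex_weight_part n"
proof -
  have c0: "conjugation 0 = 0" using conjugation_scale[of 0 0] by simp
  have "x \<in> span (\<Union>(p, q) \<in> {(p, q). p + q = n}. V (p, q))"
    using assms by (simp add: complex_weight_part_def)
  then show ?thesis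
  proof (induction rule: span_induct_alt)
    case base
    then show ?case by (simp add: c0 complex_weight_part_def span_zero)
  next
    case (step c x y)
    then obtain p q where "p + q = n" "x \<in> V (p, q)" by auto
    then have "conjugation x \<in> V (q, p)" "q + p = n" using V_conjugation[of p q] by auto
    then have "conjugation x \<in> complex_weight_part n"
      unfolding complex_weight_part_def by (intro span_base) fastforce
    then show ?case
      using step(2) unfolding complex_weight_part_def conjugation_add conjugation_scale
      by (intro span_add span_scale)
  qed
qed

text \<open>Existence rests on conjugation preserving the weight; uniqueness on the fact that a real
  subspace \<open>W\<close> has complex span \<open>W + \<i> W\<close>, while
  \<open>R.span L\<close> meets its multiple by \<open>\<i>\<close> only in
  \<open>0\<close>.\<close>

lemma real_weight_part_eq: "real_weight_part n = complex_weight_part n \<inter> R.span L"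
  unfolding real_weight_part_def complex_weight_part_def[symmetric]
proof (rule the_equality)
  let ?W = "complex_weight_part n \<inter> R.span L"
  have U: "subspace (complex_weight_part n)" by (simp add: complex_weight_part_def)
  then have "R.subspace (complex_weight_part n)"
    by (simp add: R.subspace_def subspace_def)
  then have W: "R.subspace ?W" by (intro R.subspace_inter) auto
  have "complex_weight_part n \<subseteq> span ?W"
  proof
    fix x assume x: "x \<in> complex_weight_part n"
    \<comment> \<open>The real and imaginary parts of \<open>x\<close>.\<close>
    define a b where "a = (1/2) *c (x + conjugation x)" and "b = (-\<i>/2) *c (x - conjugation x)"
    have "a \<in> complex_weight_part n" "b \<in> complex_weight_part n"
      unfolding a_def b_def using x conjugation_complex_weight_part[OF x] U
      by (blast intro: subspace_scale subspace_add subspace_diff)+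
    moreover have "a \<in> R.span L" "b \<in> R.span L"
      by (auto simp: mem_real_span_iff a_def b_def coord_scale coord_add coord_diff coord_minus
          coord_conjugation complex_is_Real_iff)
    moreover have "a + \<i> *c b = x"
      by (rule coord_eqI) (simp add: a_def b_def coord_scale coord_add coord_diff field_simps)
    ultimately show "x \<in> span ?W" by (metis IntI span_add span_scale span_base)
  qed
  moreover have "span ?W \<subseteq> complex_weight_part n" using U by (intro span_minimal) auto
  ultimately show "R.subspace ?W \<and> ?W \<subseteq> R.span L \<and> span ?W = complex_weight_part n"
    using W by auto
next
  fix W assume W: "R.subspace W \<and> W \<subseteq> R.span L \<and> span W = complex_weight_part n"
  have split: "\<exists>a\<in>W. \<exists>b\<in>W. x = a + \<i> *c b" if "x \<in> span W" for x
    using that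
  proof (induction rule: span_induct_alt)
    case base
    have "0 \<in> W" using W R.subspace_0 by blast
    then show ?case by (intro bexI[of _ 0]) auto
  next
    case (step c x y)
    then obtain a b where ab: "a \<in> W" "b \<in> W" "y = a + \<i> *c b" by blast
    have mem: "of_real r *c x + of_real s *c y \<in> W" if "x \<in> W" "y \<in> W" for r s x y
      using W that by (intro R.subspace_add R.subspace_scale) auto
    have "of_real (Re c) *c x + of_real 1 *c a \<in> W" "of_real (Im c) *c x + of_real 1 *c b \<in> W"
      using mem step ab by blast+
    moreover have "c *c x + y =
        (of_real (Re c) *c x + of_real 1 *c a) + \<i> *c (of_real (Im c) *c x + of_real 1 *c b)"
      by (rule coord_eqI) (simp add: ab coord_add coord_scale complex_eq_iff algebra_simps)
    ultimately show ?case by blast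
  qed
  show "W = complex_weight_part n \<inter> R.span L"
  proof
    show "W \<subseteq> complex_weight_part n \<inter> R.span L" using W span_superset by blast
    show "complex_weight_part n \<inter> R.span L \<subseteq> W"
    proof
      fix x assume x: "x \<in> complex_weight_part n \<inter> R.span L"
      then obtain a b where ab: "a \<in> W" "b \<in> W" "x = a + \<i> *c b" using split W by blast
      \<comment> \<open>Both \<open>b\<close> and \<open>\<i> *c b\<close> are now real vectors,
        which forces \<open>b = 0\<close>.\<close>
      have "\<i> *c b = x - a" using ab by simp
      moreover have "x - a \<in> R.span L" using x ab W by (intro R.span_diff) auto
      ultimately have "b = 0" using real_span_Int_imaginary[of b] ab W by auto
      then show "x \<in> W" using ab by simp
    qed
  qed
qed

lemma real_weight_part_subspace: "R.subspace (real_weight_part n)"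
proof -
  have "R.subspace (complex_weight_part n)"
    unfolding complex_weight_part_def R.subspace_def by (auto intro: span_zero span_add span_scale)
  then show ?thesis unfolding real_weight_part_eq by (intro R.subspace_inter R.subspace_span)
qed

end

section \<open>The weight grading of the lattice and the real extension of a pairing\<close>

context integral_hodge_structure
begin

lemma weight_part_eq: "weight_part n = {x \<in> L. h 2 x = 2 powi (- n) *c x}"
  unfolding weight_part_def real_weight_part_eq
  by (auto simp: complex_weight_part_iff_h L_real)

sublocale weight: direct_sum UNIV weight_part L
  by unfold_locales
    (use real_weight_part_subspace in
      \<open>auto simp: weight_direct_sum weight_part_def L_zero L_add R.subspace_0 R.subspace_add\<close>)

lemma biadditive_on_L:
  assumes \<psi>: "biadditive_on L \<psi>" and xy: "x \<in> L" "y \<in> L"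
  shows "\<psi> x y = (\<Sum>b\<in>basis. \<Sum>b'\<in>basis. coord b x * coord b' y * \<psi> b b')"
proof -
  have sc: "vector_space ((*) :: complex \<Rightarrow> complex \<Rightarrow> complex)"
    by unfold_locales (simp_all add: algebra_simps)
  have "\<psi> x y = (\<Sum>b\<in>basis. coord b x * \<psi> b y)"
    using \<psi> xy by (intro additive_on_L[OF sc, of "\<lambda>x. \<psi> x y"]) (auto simp: biadditive_on_def)
  also have "\<dots> = (\<Sum>b\<in>basis. coord b x * (\<Sum>b'\<in>basis. coord b' y * \<psi> b b'))"
    using \<psi> xy basis_subset
    by (intro sum.cong refl arg_cong2[of _ _ _ _ "(*)"] additive_on_L[OF sc])
      (auto simp: biadditive_on_def)
  finally show ?thesis by (simp add: sum_distrib_left mult_ac)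
qed

text \<open>The coordinate formula satisfies the specification; conversely, biadditivity reduces any
  solution to its values on real multiples of basis vectors, which are prescribed.\<close>

lemma real_extension_eq:
  assumes \<psi>: "biadditive_on L \<psi>"
  shows "real_extension \<psi> x y = (if x \<in> R.span L \<and> y \<in> R.span L
    then \<Sum>b\<in>basis. \<Sum>b'\<in>basis. coord b x * coord b' y * \<psi> b b' else 0)"
proof -
  define \<beta> where "\<beta> x y = (if x \<in> R.span L \<and> y \<in> R.span L
    then \<Sum>b\<in>basis. \<Sum>b'\<in>basis. coord b x * coord b' y * \<psi> b b' else 0)" for x y
  have "real_extension \<psi> = \<beta>"
    unfolding real_extension_def
  proof (rule the_equality)
    have "biadditive_on (R.span L) \<beta>"
      unfolding biadditive_on_def \<beta>_def
      by (auto simp: R.span_add coord_add distrib_left distrib_right sum.distrib)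
    moreover have "\<beta> (of_real a *c x) (of_real b *c y) = of_real a * of_real b * \<psi> x y"
      if xy: "x \<in> L" "y \<in> L" for a b x y
      unfolding biadditive_on_L[OF \<psi> xy]
      using xy by (simp add: \<beta>_def L_real R.span_scale coord_scale sum_distrib_left mult_ac)
    ultimately show "biadditive_on (R.span L) \<beta> \<and>
       (\<forall>a b :: real. \<forall>x\<in>L. \<forall>y\<in>L.
          \<beta> (of_real a *c x) (of_real b *c y) = of_real a * of_real b * \<psi> x y) \<and>
       (\<forall>x y. x \<notin> R.span L \<or> y \<notin> R.span L \<longrightarrow> \<beta> x y = 0)"
      by (auto simp: \<beta>_def)
    fix \<gamma> assume \<gamma>: "biadditive_on (R.span L) \<gamma> \<and>
       (\<forall>a b :: real. \<forall>x\<in>L. \<forall>y\<in>L.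
          \<gamma> (of_real a *c x) (of_real b *c y) = of_real a * of_real b * \<psi> x y) \<and>
       (\<forall>x y. x \<notin> R.span L \<or> y \<notin> R.span L \<longrightarrow> \<gamma> x y = 0)"
    \<comment> \<open>Coordinates of vectors in \<open>R.span L\<close> are real, so the prescribed
      values apply.\<close>
    have real: "\<gamma> (coord b x *c b) (coord b' y *c b') = coord b x * coord b' y * \<psi> b b'"
      if mem: "x \<in> R.span L" "y \<in> R.span L" "b \<in> basis" "b' \<in> basis" for x y b b'
    proof -
      obtain r t where "coord b x = of_real r" "coord b' y = of_real t"
        using mem unfolding mem_real_span_iff by (metis Reals_cases)
      moreover have "b \<in> L" "b' \<in> L" using mem basis_subset by auto
      ultimately show ?thesis using \<gamma> by simp
    qed
    show "\<gamma> = \<beta>"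
    proof (intro ext)
      fix x y
      show "\<gamma> x y = \<beta> x y"
      proof (cases "x \<in> R.span L \<and> y \<in> R.span L")
        case True
        then have "\<gamma> x y = (\<Sum>b\<in>basis. \<gamma> (coord b x *c b) y)"
          using \<gamma> by (intro additive_on_real_span[of "\<lambda>x. \<gamma> x y"]) (auto simp: biadditive_on_def)
        also have "\<dots> = (\<Sum>b\<in>basis. \<Sum>b'\<in>basis. \<gamma> (coord b x *c b) (coord b' y *c b'))"
          using \<gamma> True coord_scaled_mem
          by (intro sum.cong refl additive_on_real_span) (auto simp: biadditive_on_def)
        also have "\<dots> = \<beta> x y"
          using True real by (simp add: \<beta>_def)
        finally show ?thesis .
      qed (use \<gamma> in \<open>auto simp: \<beta>_def\<close>)
    qed
  qed
  then show ?thesis by (simp add: \<beta>_def)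
qed

end

section \<open>Hodge projections\<close>

context polarised_integral_hodge_structure
begin

section \<open>The real pairing and the positive definite forms of each weight\<close>

lemma psi_add_left: "x \<in> L \<Longrightarrow> y \<in> L \<Longrightarrow> z \<in> L \<Longrightarrow> \<psi> (x + y) z = \<psi> x z + \<psi> y z"
  and psi_add_right: "x \<in> L \<Longrightarrow> y \<in> L \<Longrightarrow> z \<in> L \<Longrightarrow> \<psi> x (y + z) = \<psi> x y + \<psi> x z"
  using psi_biadditive by (simp_all add: biadditive_on_def)

lemma real_extension_L: "x \<in> L \<Longrightarrow> y \<in> L \<Longrightarrow> real_extension \<psi> x y = \<psi> x y"
  by (simp add: real_extension_eq[OF psi_biadditive] biadditive_on_L[OF psi_biadditive] L_real)

lemma real_extension_add_left:
  "x \<in> R.span L \<Longrightarrow> y \<in> R.span L \<Longrightarrow>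
    real_extension \<psi> (x + y) z = real_extension \<psi> x z + real_extension \<psi> y z"
  by (simp add: real_extension_eq[OF psi_biadditive] R.span_add coord_add distrib_right sum.distrib)

lemma real_extension_scale_left:
  "x \<in> R.span L \<Longrightarrow> real_extension \<psi> (of_real a *c x) z = of_real a * real_extension \<psi> x z"
  by (simp add: real_extension_eq[OF psi_biadditive] R.span_scale coord_scale sum_distrib_left mult_ac)

lemma real_extension_add_right:
  "x \<in> R.span L \<Longrightarrow> y \<in> R.span L \<Longrightarrow>
    real_extension \<psi> z (x + y) = real_extension \<psi> z x + real_extension \<psi> z y"
  by (simp add: real_extension_eq[OF psi_biadditive] R.span_add coord_add distrib_left distrib_right sum.distrib)

lemma real_extension_scale_right:
  "x \<in> R.span L \<Longrightarrow> real_extension \<psi> z (of_real a *c x) = of_real a * real_extension \<psi> z x"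
  by (simp add: real_extension_eq[OF psi_biadditive] R.span_scale coord_scale sum_distrib_left mult_ac)

lemma real_extension_zero_right: "real_extension \<psi> z 0 = 0"
  using real_extension_scale_right[of 0 z 0] R.span_zero by simp

text \<open>Taking \<open>Re\<close> only changes the type on \<open>real_weight_part n\<close>,
  where \<open>hodge_form_real\<close> holds.\<close>

definition weight_form :: "int \<Rightarrow> 'v \<Rightarrow> 'v \<Rightarrow> real" where
  "weight_form n x y = Re (hodge_form \<psi> n x y)"

lemma real_weight_part_real: "real_weight_part n \<subseteq> R.span L"
  by (simp add: real_weight_part_eq)

sublocale form: positive_definite_form "\<lambda>(r::real) x. of_real r *c x" "real_weight_part n" "weight_form n"
  for n
proof unfold_locales
  show "R.subspace (real_weight_part n)" by (rule real_weight_part_subspace)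
next
  fix x y z assume "x \<in> real_weight_part n" "y \<in> real_weight_part n" "z \<in> real_weight_part n"
  then show "weight_form n (x + y) z = weight_form n x z + weight_form n y z"
    using real_weight_part_real[of n]
    by (simp add: weight_form_def hodge_form_def real_extension_add_left subset_iff distrib_left)
next
  fix x z a assume "x \<in> real_weight_part n"
  then have "hodge_form \<psi> n (of_real a *c x) z = of_real a * hodge_form \<psi> n x z"
    using real_weight_part_real[of n]
    by (simp add: hodge_form_def real_extension_scale_left subset_iff mult_ac)
  then show "weight_form n (of_real a *c x) z = a * weight_form n x z"
    by (simp add: weight_form_def)
qed (simp_all add: weight_form_def hodge_form_sym hodge_form_pos)

section \<open>Discreteness of the lattice in each weight\<close>

lemma weight_part_real: "weight_part n \<subseteq> real_weight_part n"
  by (simp add: weight_part_def)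

text \<open>Each coordinate is the pairing with a fixed vector \<open>w b\<close>, so Cauchy-Schwarz
  bounds it in terms of the norm; bounded integral coordinates leave finitely many vectors.\<close>

lemma weight_part_discrete: "finite {x \<in> weight_part n. weight_form n x x \<le> c}"
proof -
  have "\<exists>w\<in>real_weight_part n. \<forall>x\<in>real_weight_part n. weight_form n x w = Re (coord b x)" for b
    using real_weight_part_real[of n] real_span_basis
    by (intro form.riesz_representation[OF finite_basis]) (auto simp: coord_add coord_scale)
  then obtain w where w: "\<And>b. w b \<in> real_weight_part n"
      "\<And>b x. x \<in> real_weight_part n \<Longrightarrow> weight_form n x (w b) = Re (coord b x)"
    by metis
  \<comment> \<open>One bound for all squared coordinates. With \<open>\<bar>c\<bar>\<close> every
    term is nonnegative and hence at most the sum.\<close>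
  define D where "D = (\<Sum>b\<in>basis. \<bar>c\<bar> * weight_form n (w b) (w b))"
  \<comment> \<open>An integer is at most its square in absolute value, so the bound on squares
    serves for the coordinates too.\<close>
  define K where "K = {- \<lfloor>D\<rfloor>..\<lfloor>D\<rfloor>}"
  \<comment> \<open>The value \<open>0\<close> off the basis confines \<open>g\<close> to a finite
    set of functions.\<close>
  define g where "g x b = (if b \<in> basis then \<lfloor>Re (coord b x)\<rfloor> else 0)" for x b
  let ?S = "{x \<in> weight_part n. weight_form n x x \<le> c}"
  have int: "coord b x = of_int \<lfloor>Re (coord b x)\<rfloor>" if "x \<in> L" "b \<in> basis" for x b
    using coord_Ints[OF that] by (auto elim: Ints_cases)
  have "g x b \<in> K" if x: "x \<in> ?S" and b: "b \<in> basis" for x b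
  proof -
    let ?k = "\<lfloor>Re (coord b x)\<rfloor>"
    have W: "x \<in> real_weight_part n" using x weight_part_real by auto
    have k: "Re (coord b x) = of_int ?k"
      using int[of x b] x b by (metis (no_types, lifting) Re_complex_of_real mem_Collect_eq IntD1 of_real_of_int_eq weight_part_def)
    have "(Re (coord b x))\<^sup>2 \<le> weight_form n x x * weight_form n (w b) (w b)"
      using form.Cauchy_Schwarz[OF W w(1), of b] w(2)[OF W] by simp
    also have "\<dots> \<le> \<bar>c\<bar> * weight_form n (w b) (w b)"
      using x form.q_nonneg[OF w(1)] by (intro mult_right_mono) auto
    also have "\<dots> \<le> D"
      unfolding D_def using b finite_basis form.q_nonneg[OF w(1)]
      by (intro member_le_sum[of b basis "\<lambda>b. \<bar>c\<bar> * weight_form n (w b) (w b)"]) auto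
    finally have "of_int (?k\<^sup>2) \<le> D" using k by simp
    then have "?k\<^sup>2 \<le> \<lfloor>D\<rfloor>" by (simp add: le_floor_iff)
    moreover have "\<bar>?k\<bar> \<le> ?k\<^sup>2"
      using self_le_power[of "\<bar>?k\<bar>" 2] by (cases "?k = 0") simp_all
    ultimately show ?thesis using b by (auto simp: g_def K_def)
  qed
  then have "g ` ?S \<subseteq> {f. \<forall>b. (b \<in> basis \<longrightarrow> f b \<in> K) \<and> (b \<notin> basis \<longrightarrow> f b = 0)}"
    by (auto simp: g_def)
  then have "finite (g ` ?S)"
    by (rule finite_subset) (rule finite_set_of_finite_funs, simp_all add: finite_basis K_def)
  moreover have "inj_on g ?S"
  proof (rule inj_onI)
    fix x y assume *: "x \<in> ?S" "y \<in> ?S" "g x = g y"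
    show "x = y"
    proof (rule coord_eqI)
      fix b assume b: "b \<in> basis"
      have "\<lfloor>Re (coord b x)\<rfloor> = \<lfloor>Re (coord b y)\<rfloor>"
        using fun_cong[OF *(3), of b] b by (simp add: g_def)
      then show "coord b x = coord b y"
        using int[of x b] int[of y b] * b by (simp add: weight_part_def)
    qed
  qed
  ultimately show ?thesis by (rule finite_imageD)
qed

text \<open>Linearity is over the complex numbers on the whole space, since \<open>h\<close> moves
  vectors out of \<open>L\<close>. Orthogonality is required in both orders because
  \<open>\<psi>\<close> itself is not assumed symmetric.\<close>

definition hodge_projection :: "('v \<Rightarrow> 'v) \<Rightarrow> bool" where
  "hodge_projection P \<longleftrightarrow>
    (\<forall>x y. P (x + y) = P x + P y) \<and> (\<forall>a x. P (a *c x) = a *c P x) \<and>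
    (\<forall>x\<in>L. P x \<in> L) \<and> (\<forall>x. P (P x) = P x) \<and> (\<forall>z x. z \<noteq> 0 \<longrightarrow> P (h z x) = h z (P x)) \<and>
    (\<forall>x\<in>L. \<forall>y\<in>L. \<psi> (P x) (y - P y) = 0 \<and> \<psi> (y - P y) (P x) = 0)"

lemma hodge_projectionD:
  assumes "hodge_projection P"
  shows "P (x + y) = P x + P y" "P (a *c x) = a *c P x" "x \<in> L \<Longrightarrow> P x \<in> L" "P (P x) = P x"
    "z \<noteq> 0 \<Longrightarrow> P (h z x) = h z (P x)" "x \<in> L \<Longrightarrow> y \<in> L \<Longrightarrow> \<psi> (P x) (y - P y) = 0"
    "x \<in> L \<Longrightarrow> y \<in> L \<Longrightarrow> \<psi> (y - P y) (P x) = 0"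
  using assms unfolding hodge_projection_def by blast+

lemma hodge_projection_diff: "hodge_projection P \<Longrightarrow> P (x - y) = P x - P y"
  using hodge_projectionD(1)[of P "x - y" y] by simp

lemma hodge_projection_zero: "hodge_projection P \<Longrightarrow> P 0 = 0"
  using hodge_projectionD(2)[of P 0 0] by simp

lemma hodge_projection_weight_part:
  "hodge_projection P \<Longrightarrow> x \<in> weight_part n \<Longrightarrow> P x \<in> weight_part n"
  using hodge_projectionD(5)[of P 2 x] by (simp add: weight_part_eq hodge_projectionD)

text \<open>The form \<open>hodge_form\<close> involves \<open>h \<i> y\<close>, which need not be a
  lattice vector, so orthogonality is extended real linearly in the second argument.\<close>

lemma hodge_projection_orthogonal:
  assumes P: "hodge_projection P" and x: "x \<in> L" and "y \<in> R.span L"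
  shows "real_extension \<psi> (P x) (y - P y) = 0"
proof -
  have "y - P y \<in> R.span L \<and> real_extension \<psi> (P x) (y - P y) = 0"
    using \<open>y \<in> R.span L\<close>
  proof (induction rule: R.span_induct_alt)
    case base
    then show ?case by (simp add: hodge_projection_zero[OF P] real_extension_zero_right R.span_zero)
  next
    case (step a y z)
    have eq: "of_real a *c y + z - P (of_real a *c y + z) = of_real a *c (y - P y) + (z - P z)"
      by (simp add: hodge_projectionD(1,2)[OF P] scale_right_diff_distrib)
    have L: "y - P y \<in> L" "P x \<in> L" using step(1) x hodge_projectionD(3)[OF P] L_diff by auto
    have "real_extension \<psi> (P x) (y - P y) = 0"
      using L x step(1) by (simp add: real_extension_L hodge_projectionD(6)[OF P])
    then show ?case
      unfolding eq using step(2) L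
      by (simp add: real_extension_add_right real_extension_scale_right R.span_add R.span_scale L_real)
  qed
  then show ?thesis ..
qed

text \<open>Pythagoras: \<open>P\<close> commutes with \<open>h \<i>\<close>, so
  \<open>h \<i> (x - P x)\<close> is again a vector minus its projection and is orthogonal to
  \<open>P x\<close> for the real pairing.\<close>

lemma weight_form_hodge_projection:
  assumes P: "hodge_projection P" and x: "x \<in> weight_part n"
  shows "weight_form n x x = weight_form n (P x) (P x) + weight_form n (x - P x) (x - P x)"
proof -
  have xL: "x \<in> L" using x by (simp add: weight_part_def)
  define u v where "u = P x" and "v = x - P x"
  have "x \<in> real_weight_part n" "u \<in> real_weight_part n"
    using x hodge_projection_weight_part[OF P x] weight_part_real by (auto simp: u_def)
  moreover from this have "v \<in> real_weight_part n"
    unfolding v_def u_def by (rule R.subspace_diff[OF real_weight_part_subspace])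
  ultimately have W: "u \<in> real_weight_part n" "v \<in> real_weight_part n" "u + v \<in> real_weight_part n"
    by (simp_all add: u_def v_def)
  have "h \<i> v = h \<i> x - P (h \<i> x)"
    using h_add[of \<i> v "P x"] hodge_projectionD(5)[OF P, of \<i> x] by (simp add: v_def)
  then have "weight_form n u v = 0"
    using hodge_projection_orthogonal[OF P xL h_real[OF L_real[OF xL]]]
    by (simp add: weight_form_def hodge_form_def u_def)
  then have "weight_form n (u + v) (u + v) = weight_form n u u + weight_form n v v"
    using W form.q_sym[of v n u] by (simp add: form.q_add_left form.q_add_right)
  then show ?thesis by (simp add: u_def v_def)
qed

text \<open>Descent applies in each weight separately, since each weight has its own positive
  definite form; additivity then sums over the weight components.\<close>

lemma hodge_projections_commute:
  assumes P: "hodge_projection P" and Q: "hodge_projection Q" and "x \<in> L"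
  shows "P (Q x) = Q (P x)"
proof -
  have W: "P (Q x) = Q (P x)" if "x \<in> weight_part n" for x n
  proof (rule norm_splitting_maps_commute[of "weight_part n" "\<lambda>x. weight_form n x x"])
    show "finite {x \<in> weight_part n. weight_form n x x \<le> c}" for c by (rule weight_part_discrete)
    show "weight_form n x x > 0" if "x \<in> weight_part n" "x \<noteq> 0" for x
      using that weight_part_real by (intro form.q_pos) auto
    show "x - y \<in> weight_part n" if "x \<in> weight_part n" "y \<in> weight_part n" for x y
      using that real_weight_part_subspace[of n]
      by (simp add: weight_part_def L_diff R.subspace_diff)
  qed (use that P Q in \<open>simp_all add: hodge_projection_weight_part hodge_projectionD(1)
      weight_form_hodge_projection[symmetric]\<close>)
  let ?J = "{n. weight.component x n \<noteq> 0}"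
  have C: "P (Q (weight.component x n)) = Q (P (weight.component x n))" for n
    by (rule W, rule weight.component_mem) (use \<open>x \<in> L\<close> in auto)
  have x: "x = (\<Sum>n\<in>?J. weight.component x n)"
    using weight.sum_component[OF \<open>x \<in> L\<close> weight.finite_component[OF \<open>x \<in> L\<close>]] by simp
  have "P (Q (\<Sum>n\<in>?J. weight.component x n)) = Q (P (\<Sum>n\<in>?J. weight.component x n))"
    by (simp only: sum_additive[of P, OF hodge_projectionD(1)[OF P]]
        sum_additive[of Q, OF hodge_projectionD(1)[OF Q]] C)
  then show ?thesis using x by simp
qed

lemma span_image_stable:
  assumes T: "\<And>x y. T (x + y) = T x + T y" "\<And>a x. T (a *c x) = a *c T x"
    and h: "\<And>x. T (h z x) = h z (T x)"
  shows "h z ` R.span (T ` L) \<subseteq> R.span (T ` L)"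
proof -
  have T0: "T 0 = 0" using T(2)[of 0 0] by simp
  have h0: "h z 0 = 0" using h_scale[of z 0 0] by simp
  have T_span: "T x \<in> R.span (T ` L)" if "x \<in> R.span L" for x
    using that
    by (induction rule: R.span_induct_alt) (auto simp: T T0 R.span_zero R.span_base intro!: R.span_add R.span_scale)
  have "h z x \<in> R.span (T ` L)" if "x \<in> R.span (T ` L)" for x
    using that
  proof (induction rule: R.span_induct_alt)
    case base
    then show ?case by (simp add: h0 R.span_zero)
  next
    case (step a x y)
    then obtain u where u: "u \<in> L" "x = T u" by auto
    have "h z x \<in> R.span (T ` L)" unfolding u(2) h[symmetric] by (intro T_span h_real L_real u)
    then show ?case using step(2) by (simp add: h_add h_scale R.span_add R.span_scale)
  qed
  then show ?thesis by blast
qed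

lemma indecomposable_hodge_projection:
  assumes P: "hodge_projection P" and Q: "hodge_projection Q" and ind: "indecomposable (P ` L)"
  shows "(\<forall>x\<in>L. Q (P x) = 0) \<or> (\<forall>x\<in>L. Q (P x) = P x)"
proof -
  note comm = hodge_projections_commute[OF P Q]
  note PD = hodge_projectionD[OF P] and QD = hodge_projectionD[OF Q]
  note diff = hodge_projection_diff[OF P] hodge_projection_diff[OF Q]
  define X where "X = (\<lambda>x. Q (P x)) ` L"
  define Y where "Y = (\<lambda>x. P x - Q (P x)) ` L"
  let ?N = "\<lambda>k::nat. if k = 1 then X else Y"
  \<comment> \<open>Both summands are images of \<open>L\<close> under linear maps commuting with
    \<open>h\<close>, so the subgroup and stability conditions are proved once for such
    images.\<close>
  have N: "\<exists>T. ?N k = T ` L \<and> (\<forall>x y. T (x + y) = T x + T y) \<and> (\<forall>a x. T (a *c x) = a *c T x) \<and>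
      (\<forall>z x. z \<noteq> 0 \<longrightarrow> T (h z x) = h z (T x))" for k
  proof -
    have h_diff: "h z (x - y) = h z x - h z y" for z x y
      using h_add[of z "x - y" y] by simp
    show ?thesis
      by (rule exI[of _ "if k = 1 then (\<lambda>x. Q (P x)) else (\<lambda>x. P x - Q (P x))"])
        (simp add: X_def Y_def PD QD h_diff scale_right_diff_distrib del: One_nat_def)
  qed
  have "internal_direct_sum {1..2} ?N (P ` L)"
  proof (rule internal_direct_sum_pair[where T = Q])
    \<comment> \<open>Commutation enters here: \<open>Q (P x)\<close> is rewritten as
      \<open>P (Q x)\<close>.\<close>
    show "X \<subseteq> P ` L"
    proof
      fix y assume "y \<in> X"
      then obtain x where x: "x \<in> L" "y = P (Q x)" unfolding X_def using comm by auto
      then show "y \<in> P ` L" using QD(3) by blast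
    qed
    show "Y \<subseteq> P ` L"
    proof
      fix y assume "y \<in> Y"
      then obtain x where x: "x \<in> L" "y = P x - Q (P x)" unfolding Y_def by auto
      then have "y = P (x - Q x)" by (simp add: diff comm)
      then show "y \<in> P ` L" using x QD(3) L_diff by blast
    qed
    show "x + y \<in> P ` L" if xy: "x \<in> P ` L" "y \<in> P ` L" for x y
    proof -
      obtain u v where "u \<in> L" "v \<in> L" "x = P u" "y = P v" using xy by auto
      then show ?thesis using L_add[of u v] by (auto simp: PD(1)[symmetric])
    qed
  qed (auto simp: X_def Y_def QD diff)
  moreover have "Z.subspace (?N k)" for k
  proof -
    obtain T where T: "?N k = T ` L" "\<forall>x y. T (x + y) = T x + T y" "\<forall>a x. T (a *c x) = a *c T x"
      using N by blast
    have T0: "T 0 = 0" using T(3)[rule_format, of 0 0] by simp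
    show ?thesis unfolding T(1) Z.subspace_def
    proof (intro conjI ballI allI)
      show "0 \<in> T ` L" using T0 L_zero by (metis imageI)
      show "x + y \<in> T ` L" if "x \<in> T ` L" "y \<in> T ` L" for x y
        using that T(2) L_add by (metis (no_types, lifting) image_iff)
      show "of_int c *c x \<in> T ` L" if "x \<in> T ` L" for x c
        using that T(3) L_scale by (metis (no_types, lifting) image_iff)
    qed
  qed
  moreover have "h z ` R.span (?N k) \<subseteq> R.span (?N k)" if "z \<noteq> 0" for z k
  proof -
    obtain T where T: "?N k = T ` L" "\<forall>x y. T (x + y) = T x + T y" "\<forall>a x. T (a *c x) = a *c T x"
      "\<forall>z x. z \<noteq> 0 \<longrightarrow> T (h z x) = h z (T x)"
      using N by blast
    show ?thesis unfolding T(1) using T(2-4) that by (intro span_image_stable) auto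
  qed
  moreover have "\<psi> x y = 0" "\<psi> y x = 0" if "x \<in> X" "y \<in> Y" for x y
    using that PD(3) QD(6,7) unfolding X_def Y_def by auto
  ultimately have "orthogonal_decomposition (P ` L) 2 ?N"
    unfolding orthogonal_decomposition_def by (auto split: if_splits)
  then have "X = {0} \<or> Y = {0}" using ind unfolding indecomposable_def by fastforce
  moreover have "Q (P x) \<in> X" "P x - Q (P x) \<in> Y" if "x \<in> L" for x
    using that unfolding X_def Y_def by blast+
  ultimately show ?thesis by (metis singletonD right_minus_eq)
qed

lemma orthogonal_decomposition_projections:
  assumes N: "orthogonal_decomposition L r N"
  shows "\<exists>p. (\<forall>k\<in>{1..r}. hodge_projection (p k) \<and> p k ` L = N k) \<and>
    (\<forall>x\<in>L. (\<Sum>k\<in>{1..r}. p k x) = x)"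
proof -
  note [simp del] = One_nat_def
  have sub: "Z.subspace (N k)" if "k \<in> {1..r}" for k
    using N that unfolding orthogonal_decomposition_def by blast
  have stable: "h z x \<in> R.span (N k)" if "k \<in> {1..r}" "z \<noteq> 0" "x \<in> R.span (N k)" for k z x
    using N that unfolding orthogonal_decomposition_def by blast
  have orth: "\<psi> x y = 0" if "k \<in> {1..r}" "j \<in> {1..r}" "k \<noteq> j" "x \<in> N k" "y \<in> N j" for k j x y
    using N that unfolding orthogonal_decomposition_def by blast
  interpret D: direct_sum "{1..r}" N L
    using N sub by unfold_locales
      (auto simp: orthogonal_decomposition_def intro: Z.subspace_0 Z.subspace_add)
  \<comment> \<open>The component maps are additive on \<open>L\<close> only; this is their complex
    linear extension.\<close>
  define p where "p k x = (\<Sum>b\<in>basis. coord b x *c D.component b k)" for k x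
  have p_add: "p k (x + y) = p k x + p k y" for k x y
    by (simp add: p_def coord_add scale_left_distrib sum.distrib)
  have p_scale: "p k (a *c x) = a *c p k x" for k a x
    by (simp add: p_def coord_scale scale_sum_right)
  have p_L: "p k x = D.component x k" if "x \<in> L" for k x
    unfolding p_def
    by (rule additive_on_L[OF vector_space_axioms, of "\<lambda>x. D.component x k", symmetric])
      (use that in \<open>simp_all add: D.component_add\<close>)
  have p_mem: "p k x \<in> N k" if "x \<in> L" "k \<in> {1..r}" for k x
    using p_L D.component_mem that by simp
  have N_L: "N k \<subseteq> L" if "k \<in> {1..r}" for k using D.summand_subset that by blast
  have p_N: "p k x = (if k = j then x else 0)" if "x \<in> N j" "j \<in> {1..r}" for k j x
    using that N_L by (subst p_L) (auto simp: D.component_summand[OF that(2,1)])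
  have p0: "p k 0 = 0" for k using p_scale[of k 0 0] by simp
  \<comment> \<open>Needed because \<open>h z\<close> carries \<open>N j\<close> into
    \<open>R.span (N j)\<close> rather than into \<open>N j\<close>.\<close>
  have p_span: "p k x = (if k = j then x else 0)" if "x \<in> R.span (N j)" "j \<in> {1..r}" for k j x
    using that(1)
    by (induction rule: R.span_induct_alt) (use p_N[OF _ that(2)] in \<open>auto simp: p_add p_scale p0\<close>)
  have sum_p: "(\<Sum>k\<in>{1..r}. p k x) = x" if "x \<in> L" for x
  proof -
    have "(\<Sum>k\<in>{1..r}. D.component x k) = x"
      using D.component_outside[OF that] by (intro D.sum_component that finite_atLeastAtMost) blast
    then show ?thesis by (simp add: p_L that)
  qed
  have extend: "f x = g x"
    if "\<And>x y. f (x + y) = f x + f y" "\<And>a x. f (a *c x) = a *c f x"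
      "\<And>x y. g (x + y) = g x + g y" "\<And>a x. g (a *c x) = a *c g x"
      "\<And>x. x \<in> L \<Longrightarrow> f x = g x" for f g :: "'v \<Rightarrow> 'v" and x
  proof -
    have "f (\<Sum>b\<in>basis. coord b x *c b) = g (\<Sum>b\<in>basis. coord b x *c b)"
      using that(5) basis_subset
      unfolding sum_additive[of f, OF that(1)] sum_additive[of g, OF that(3)] that(2,4)
      by (intro sum.cong) auto
    then show ?thesis by (simp only: sum_coord)
  qed
  have proj: "hodge_projection (p k)" if k: "k \<in> {1..r}" for k
    unfolding hodge_projection_def
  proof (intro conjI allI ballI impI)
    show "p k x \<in> L" if "x \<in> L" for x using p_mem N_L that k by blast
    show "p k (p k x) = p k x" for x
      by (rule extend) (use p_N[OF p_mem[OF _ k] k] in \<open>simp_all add: p_add p_scale\<close>)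
    show "p k (h z x) = h z (p k x)" if z: "z \<noteq> 0" for z x
    proof (rule extend[of "\<lambda>x. p k (h z x)" "\<lambda>x. h z (p k x)"])
      fix x assume x: "x \<in> L"
      \<comment> \<open>Each \<open>h z (p j x)\<close> stays in \<open>R.span (N j)\<close>, on
        which \<open>p k\<close> is the identity or zero, so only the term \<open>j = k\<close>
        survives.\<close>
      have "p k (h z (\<Sum>j\<in>{1..r}. p j x)) = (\<Sum>j\<in>{1..r}. p k (h z (p j x)))"
        by (simp only: sum_additive[of "h z", OF h_add] sum_additive[of "p k", OF p_add])
      also have "\<dots> = (\<Sum>j\<in>{1..r}. if k = j then h z (p j x) else 0)"
        using p_mem[OF x] z
        by (intro sum.cong refl p_span stable R.span_base)
      also have "\<dots> = h z (p k x)" using k by simp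
      finally show "p k (h z x) = h z (p k x)" using sum_p[OF x] by simp
    qed (simp_all add: p_add p_scale h_add h_scale)
    fix x y assume x: "x \<in> L" and y: "y \<in> L"
    have eq: "y - p k y = (\<Sum>j\<in>{1..r} - {k}. p j y)"
      using sum_p[OF y] k by (simp add: sum_diff1)
    have pL: "p k x \<in> L" "\<And>j. j \<in> {1..r} - {k} \<Longrightarrow> p j y \<in> L" using p_mem N_L x y k by blast+
    have orth_p: "\<psi> (p k x) (p j y) = 0" "\<psi> (p j y) (p k x) = 0" if "j \<in> {1..r} - {k}" for j
      using that orth[OF k _ _ p_mem[OF x k] p_mem[OF y]] orth[OF _ k _ p_mem[OF y] p_mem[OF x k]]
      by blast+
    have "\<psi> (p k x) (\<Sum>j\<in>{1..r} - {k}. p j y) = (\<Sum>j\<in>{1..r} - {k}. \<psi> (p k x) (p j y))"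
      by (rule sum_additive_on[of L]) (use pL in \<open>simp_all add: L_zero L_add psi_add_right\<close>)
    then show "\<psi> (p k x) (y - p k y) = 0"
      unfolding eq by (simp add: orth_p)
    have "\<psi> (\<Sum>j\<in>{1..r} - {k}. p j y) (p k x) = (\<Sum>j\<in>{1..r} - {k}. \<psi> (p j y) (p k x))"
      by (rule sum_additive_on[of L "\<lambda>u. \<psi> u (p k x)"])
        (use pL in \<open>simp_all add: L_zero L_add psi_add_left\<close>)
    then show "\<psi> (y - p k y) (p k x) = 0"
      unfolding eq by (simp add: orth_p)
  qed (simp_all add: p_add p_scale)
  have image: "p k ` L = N k" if k: "k \<in> {1..r}" for k
  proof
    show "p k ` L \<subseteq> N k" using p_mem k by blast
    show "N k \<subseteq> p k ` L"
    proof
      fix x assume x: "x \<in> N k"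
      then have "x = p k x" using p_N[OF x k, of k] by simp
      then show "x \<in> p k ` L" using x N_L[OF k] by blast
    qed
  qed
  show ?thesis using proj image sum_p by blast
qed

text \<open>Some \<open>q j\<close> does not kill a given nonzero \<open>p i x\<close>. Since the
  projections commute, neither product vanishes, so indecomposability of both images makes each
  projection the identity on the image of the other, and the images coincide.\<close>

lemma indecomposable_summands_subset:
  assumes M: "orthogonal_decomposition L r M" "\<And>i. i \<in> {1..r} \<Longrightarrow> indecomposable (M i)"
    and N: "orthogonal_decomposition L s N" "\<And>j. j \<in> {1..s} \<Longrightarrow> indecomposable (N j)"
  shows "M ` {1..r} \<subseteq> N ` {1..s}"
proof
  fix A assume "A \<in> M ` {1..r}"
  then obtain i where i: "i \<in> {1..r}" "A = M i" by blast
  obtain p where "\<forall>k\<in>{1..r}. hodge_projection (p k) \<and> p k ` L = M k"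
    using orthogonal_decomposition_projections[OF M(1)] by blast
  then have P: "hodge_projection (p i)" and p: "p i ` L = M i" using i by blast+
  obtain q where q: "\<forall>k\<in>{1..s}. hodge_projection (q k) \<and> q k ` L = N k"
      "\<forall>x\<in>L. (\<Sum>k\<in>{1..s}. q k x) = x"
    using orthogonal_decomposition_projections[OF N(1)] by blast
  have indP: "indecomposable (p i ` L)" unfolding p by (rule M(2)[OF i(1)])
  have "p i ` L \<noteq> {0}" using indP unfolding indecomposable_def by blast
  moreover have "p i 0 \<in> p i ` L" using L_zero by (rule imageI)
  ultimately obtain x where x: "x \<in> L" "p i x \<noteq> 0"
    unfolding hodge_projection_zero[OF P] by blast
  have "(\<Sum>k\<in>{1..s}. q k (p i x)) \<noteq> 0"
    using bspec[OF q(2) hodge_projectionD(3)[OF P x(1)]] x(2) by simp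
  then obtain j where j: "j \<in> {1..s}" "q j (p i x) \<noteq> 0" by (rule sum.not_neutral_contains_not_neutral)
  have Q: "hodge_projection (q j)" and qj: "q j ` L = N j" using q(1) j(1) by blast+
  have indQ: "indecomposable (q j ` L)" unfolding qj by (rule N(2)[OF j(1)])
  have "p i (q j x) \<noteq> 0" using j(2) hodge_projections_commute[OF P Q x(1)] by simp
  then have 1: "\<forall>y\<in>L. q j (p i y) = p i y" and 2: "\<forall>y\<in>L. p i (q j y) = q j y"
    using indecomposable_hodge_projection[OF P Q indP] indecomposable_hodge_projection[OF Q P indQ]
      j(2) x(1) by blast+
  have "p i ` L = q j ` L"
  proof
    show "p i ` L \<subseteq> q j ` L"
      using 1 hodge_projectionD(3)[OF P] by force
    show "q j ` L \<subseteq> p i ` L"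
      using 2 hodge_projectionD(3)[OF Q] by force
  qed
  then have "A = N j" unfolding p qj i(2) .
  then show "A \<in> N ` {1..s}" using j by blast
qed

end

theorem theorem1p5:
  fixes scale :: "complex \<Rightarrow> 'v::ab_group_add \<Rightarrow> 'v"
    and L :: "'v set" and V :: "int \<times> int \<Rightarrow> 'v set" and \<psi> :: "'v \<Rightarrow> 'v \<Rightarrow> complex"
    and r s :: nat and M N :: "nat \<Rightarrow> 'v set"
  assumes "polarised_integral_hodge_structure scale L V \<psi>"
    and "polarised_integral_hodge_structure.orthogonal_decomposition scale V \<psi> L r M"
    and "\<And>i. i \<in> {1..r} \<Longrightarrow> polarised_integral_hodge_structure.indecomposable scale V \<psi> (M i)"
    and "polarised_integral_hodge_structure.orthogonal_decomposition scale V \<psi> L s N"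
    and "\<And>j. j \<in> {1..s} \<Longrightarrow> polarised_integral_hodge_structure.indecomposable scale V \<psi> (N j)"
  shows "N ` {1..s} = M ` {1..r}"
proof -
  interpret polarised_integral_hodge_structure scale L V \<psi> by fact
  show ?thesis
    using indecomposable_summands_subset[OF assms(4,5,2,3)]
      indecomposable_summands_subset[OF assms(2-5)] by (rule equalityI)
qed

end
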